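(* Let $\tau\in[0,T)$ and $\Xi_\tau=(\hat\xi,\tilde\xi)\in M^2_\tau$. (Dissipation inequality in integral form) For every $t\in(\tau,T]$ and every $u\in C([\tau,t];\mathbb{R}^m)$, $$W_\tau(\Xi_\tau)\le\int_\tau^t\big[\|Cw(r;\tau,\Xi_\tau,u)-y(r)\|^2+\|u(r)\|^2\big]\,dr+W_t\big(\Xi(t;\tau,\Xi_\tau,u)\big),$$ and equality holds if and only if $u(r)=u^+_\tau(r;\Xi_\tau)$ for $r\in[\tau,t)$. (Dissipation inequality in differential form) For every $u\in C([\tau,T];\mathbb{R}^m)$, $$-\big[\|C\hat\xi-y(\tau)\|^2+\|u(\tau)\|^2\big]\le\liminf_{h\to0^+}\frac{W_{\tau+h}\big(\Xi(\tau+h;\tau,\Xi_\tau,u)\big)-W_\tau(\Xi_\tau)}{h},$$ and equality holds if $u=u^+_\tau(\cdot;\Xi_\tau)$.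
   Context: Fix $T>0$, constant real matrices $A\in\mathbb{R}^{d\times d}$, $B\in\mathbb{R}^{d\times m}$, $C\in\mathbb{R}^{p\times d}$, a continuous function $N:[0,T]\to\mathbb{R}^{d\times d}$ and a continuous reference signal $y:[0,T]\to\mathbb{R}^p$. For $\tau\in(0,T]$ let $M^2_\tau=\mathbb{R}^d\times L^2(0,\tau;\mathbb{R}^d)$ with elements $\Xi_\tau=(\hat\xi,\tilde\xi)$; for $\tau=0$ the initial condition is $\Xi_0=\hat\xi\in M^2_0=\mathbb{R}^d$. For a control $u$ on an interval starting at $\tau$, $w(\cdot)=w(\cdot;\tau,\Xi_\tau,u)$ denotes the solution for times $r\ge\tau$ of $$w'(r)=Aw(r)+\int_\tau^rN(r-s)w(s)\,ds+Bu(r)+\int_0^\tau N(r-s)\tilde\xi(s)\,ds,\qquad w(\tau)=\hat\xi,$$ extended to $(0,\tau)$ by $w(r;\tau,\Xi_\tau,u)=\tilde\xi(r)$. For $r\ge\tau$ put $$\Xi(r;\tau,\Xi_\tau,u)=\big(w(r;\tau,\Xi_\tau,u),\ w(\cdot;\tau,\Xi_\tau,u)|_{(0,r)}\big)\in M^2_r.$$ For $\tau\in[0,T)$ put $J_\tau(\Xi_\tau;u)=\int_\tau^T\big[\|Cw(r;\tau,\Xi_\tau,u)-y(r)\|^2+\|u(r)\|^2\big]\,dr$ and $W_\tau(\Xi_\tau)=\min_{u\in L^2(\tau,T;\mathbb{R}^m)}J_\tau(\Xi_\tau;u)$; also $W_T=0$. The minimizer is unique, is denoted $u^+_\tau(\cdot;\Xi_\tau)$,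 and is continuous on $[\tau,T]$ (its continuous representative is used). *)

theory Defs
  imports "HOL-Analysis.Analysis"
begin

text \<open>
  Elements of \<open>L\<^sup>2\<close> and of the state spaces are represented by total functions, of which only the
  values on the relevant interval matter. All integrals are Lebesgue (Bochner) integrals.
\<close>

definition L2_on :: "real set \<Rightarrow> (real \<Rightarrow> real ^ 'n) \<Rightarrow> bool" where
  "L2_on S f \<longleftrightarrow>
     set_borel_measurable lebesgue S f \<and> set_integrable lebesgue S (\<lambda>s. (norm (f s))\<^sup>2)"

text \<open>For \<open>\<tau> = 0\<close> the condition on the second component is vacuous, and nothing below depends on
  that component, so that \<open>M2 0\<close> represents \<open>\<real>\<^sup>d\<close>.\<close>

definition M2 :: "real \<Rightarrow> ((real ^ 'd) \<times> (real \<Rightarrow> real ^ 'd)) set" where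
  "M2 \<tau> = {\<Xi>. L2_on {0<..<\<tau>} (snd \<Xi>)}"

text \<open>\<open>w\<close> is absolutely continuous on \<open>[a, b]\<close> with a.e. derivative \<open>v\<close>, i.e. \<open>w \<in> W\<^sup>1\<^sup>,\<^sup>1(a, b)\<close>
  with weak derivative \<open>v\<close>.\<close>

definition has_ae_derivative_on ::
    "(real \<Rightarrow> real ^ 'd) \<Rightarrow> (real \<Rightarrow> real ^ 'd) \<Rightarrow> real \<Rightarrow> real \<Rightarrow> bool" where
  "has_ae_derivative_on w v a b \<longleftrightarrow>
     set_integrable lebesgue {a..b} v \<and>
     (\<forall>r\<in>{a..b}. w r = w a + (LINT q:{a..r}|lebesgue. v q))"

text \<open>Solutions on \<open>[\<tau>, e]\<close> for a control on \<open>[\<tau>, e]\<close>. Controls are in general only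
  square-integrable, so solutions are understood in the sense of Caratheodory.\<close>

definition is_solution ::
    "real ^ 'd ^ 'd \<Rightarrow> real ^ 'm ^ 'd \<Rightarrow> (real \<Rightarrow> real ^ 'd ^ 'd) \<Rightarrow> real \<Rightarrow> real \<Rightarrow>
     (real ^ 'd) \<times> (real \<Rightarrow> real ^ 'd) \<Rightarrow> (real \<Rightarrow> real ^ 'm) \<Rightarrow> (real \<Rightarrow> real ^ 'd) \<Rightarrow> bool" where
  "is_solution A B N e \<tau> \<Xi> u w \<longleftrightarrow>
     w \<tau> = fst \<Xi> \<and>
     (\<exists>w'. has_ae_derivative_on w w' \<tau> e \<and>
        (AE r in lebesgue. r \<in> {\<tau>..e} \<longrightarrow>
           w' r = A *v w r + (LINT s:{\<tau>..r}|lebesgue. N (r - s) *v w s) + B *v u r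
                  + (LINT s:{0<..<\<tau>}|lebesgue. N (r - s) *v snd \<Xi> s)))"

text \<open>The trajectory \<open>w(\<cdot>; \<tau>, \<Xi>, u)\<close> up to the end \<open>e\<close> of the interval on which \<open>u\<close> is given,
  extended to the left of \<open>\<tau>\<close> by the second component of \<open>\<Xi>\<close>.\<close>

definition traj ::
    "real ^ 'd ^ 'd \<Rightarrow> real ^ 'm ^ 'd \<Rightarrow> (real \<Rightarrow> real ^ 'd ^ 'd) \<Rightarrow> real \<Rightarrow> real \<Rightarrow>
     (real ^ 'd) \<times> (real \<Rightarrow> real ^ 'd) \<Rightarrow> (real \<Rightarrow> real ^ 'm) \<Rightarrow> real \<Rightarrow> real ^ 'd" where
  "traj A B N e \<tau> \<Xi> u r =
     (if r < \<tau> then snd \<Xi> r else (SOME w. is_solution A B N e \<tau> \<Xi> u w) r)"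

text \<open>The restriction to \<open>(0, r)\<close> is rendered as extension by zero.\<close>

definition state ::
    "real ^ 'd ^ 'd \<Rightarrow> real ^ 'm ^ 'd \<Rightarrow> (real \<Rightarrow> real ^ 'd ^ 'd) \<Rightarrow> real \<Rightarrow> real \<Rightarrow>
     (real ^ 'd) \<times> (real \<Rightarrow> real ^ 'd) \<Rightarrow> (real \<Rightarrow> real ^ 'm) \<Rightarrow> real \<Rightarrow>
     (real ^ 'd) \<times> (real \<Rightarrow> real ^ 'd)" where
  "state A B N e \<tau> \<Xi> u r =
     (traj A B N e \<tau> \<Xi> u r,
      \<lambda>s. if s \<in> {0<..<r} then traj A B N e \<tau> \<Xi> u s else 0)"

definition running_cost ::
    "real ^ 'd ^ 'p \<Rightarrow> (real \<Rightarrow> real ^ 'p) \<Rightarrow> real \<Rightarrow> real ^ 'd \<Rightarrow> real ^ 'm \<Rightarrow> real" where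
  "running_cost C y r x v = (norm (C *v x - y r))\<^sup>2 + (norm v)\<^sup>2"

definition J ::
    "real ^ 'd ^ 'd \<Rightarrow> real ^ 'm ^ 'd \<Rightarrow> real ^ 'd ^ 'p \<Rightarrow> (real \<Rightarrow> real ^ 'd ^ 'd) \<Rightarrow>
     (real \<Rightarrow> real ^ 'p) \<Rightarrow> real \<Rightarrow> real \<Rightarrow>
     (real ^ 'd) \<times> (real \<Rightarrow> real ^ 'd) \<Rightarrow> (real \<Rightarrow> real ^ 'm) \<Rightarrow> real" where
  "J A B C N y T \<tau> \<Xi> u =
     (LINT r:{\<tau>..T}|lebesgue. running_cost C y r (traj A B N T \<tau> \<Xi> u r) (u r))"

definition W ::
    "real ^ 'd ^ 'd \<Rightarrow> real ^ 'm ^ 'd \<Rightarrow> real ^ 'd ^ 'p \<Rightarrow> (real \<Rightarrow> real ^ 'd ^ 'd) \<Rightarrow>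
     (real \<Rightarrow> real ^ 'p) \<Rightarrow> real \<Rightarrow> real \<Rightarrow> (real ^ 'd) \<times> (real \<Rightarrow> real ^ 'd) \<Rightarrow> real" where
  "W A B C N y T \<tau> \<Xi> =
     (if \<tau> < T
      then (LEAST c. \<exists>u. L2_on {\<tau><..<T} u \<and> c = J A B C N y T \<tau> \<Xi> u)
      else 0)"

text \<open>The continuous representative of the minimizer; its values outside \<open>[\<tau>, T]\<close> are
  unspecified.\<close>

definition uplus ::
    "real ^ 'd ^ 'd \<Rightarrow> real ^ 'm ^ 'd \<Rightarrow> real ^ 'd ^ 'p \<Rightarrow> (real \<Rightarrow> real ^ 'd ^ 'd) \<Rightarrow>
     (real \<Rightarrow> real ^ 'p) \<Rightarrow> real \<Rightarrow> real \<Rightarrow>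
     (real ^ 'd) \<times> (real \<Rightarrow> real ^ 'd) \<Rightarrow> real \<Rightarrow> real ^ 'm" where
  "uplus A B C N y T \<tau> \<Xi> =
     (SOME u. continuous_on {\<tau>..T} u \<and> L2_on {\<tau><..<T} u \<and>
        (\<forall>v. L2_on {\<tau><..<T} v \<longrightarrow> J A B C N y T \<tau> \<Xi> u \<le> J A B C N y T \<tau> \<Xi> v))"

end

theory Submission
  imports Defs
begin

text \<open>
  The control enters affinely, so the cost is a quadratic functional, and its unique minimizer is
  found from the optimality condition \<open>u = - B\<^sup>T p\<close>, where \<open>p\<close> solves the adjoint backward
  Volterra equation. Eliminating \<open>p\<close> gives \<open>u + \<Lambda> u = f\<close> with \<open>\<Lambda>\<close> bounded on continuous
  functions and positive for the \<open>L\<^sup>2\<close> inner product. Since \<open>\<Lambda>\<close> maps \<open>L\<^sup>2\<close> boundedly into the continuous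
  functions, positivity bounds the sup norm of \<open>u\<close> by that of \<open>u + l *\<^sub>R \<Lambda> u\<close> uniformly in \<open>l \<in> [0, 1]\<close>,
  so that the equation is solvable by continuation in \<open>l\<close>. In this way the minimizer is continuous from the
  outset and completeness of \<open>L\<^sup>2\<close> is not needed. Existence for the state and the adjoint equation is obtained by
  the same continuation argument from Gronwall's inequality.

  Expanding the cost around the minimizer \<open>u\<^sup>+\<close> gives \<open>J v \<ge> J u\<^sup>+ + \<parallel>v - u\<^sup>+\<parallel>\<^sup>2\<close>. Solutions restart at an
  intermediate time with the state as new initial condition, hence the cost splits there; gluing a control
  with the minimizer for its state yields the integral inequality, and strictness of the minimum its equality case.
  The differential form is the limit of difference quotients.
\<close>

section \<open>Integral operators with convolution kernels\<close>

text \<open>The norm of a matrix, as a nested vector, is the Frobenius norm, so this is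
  Cauchy-Schwarz row by row.\<close>

lemma norm_matrix_vector_mult_le:
  fixes M :: "real^'n^'m"
  shows "norm (M *v x) \<le> norm M * norm x"
proof -
  have "norm (M *v x) \<le> L2_set (\<lambda>i. norm (M $ i) * norm x) UNIV"
    unfolding norm_vec_def[of "M *v x"]
    by (rule L2_set_mono) (auto simp: matrix_vector_mul_component Cauchy_Schwarz_ineq2)
  also have "\<dots> = norm M * norm x"
    by (simp add: norm_vec_def[of M] L2_set_left_distrib)
  finally show ?thesis .
qed

lemma bounded_bilinear_matrix_vector_mult:
  "bounded_bilinear ((*v) :: real^'n^'m \<Rightarrow> real^'n \<Rightarrow> real^'m)"
proof
  show "\<exists>K. \<forall>(M::real^'n^'m) x. norm (M *v x) \<le> norm M * norm x * K"
    by (rule exI[of _ 1]) (simp add: norm_matrix_vector_mult_le)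
qed (simp_all add: matrix_vector_mult_add_rdistrib matrix_vector_right_distrib
       scaleR_matrix_vector_assoc matrix_vector_mult_scaleR)

lemmas bilinear_matrix_vector_mult =
  bounded_bilinear_matrix_vector_mult[unfolded bilinear_conv_bounded_bilinear[symmetric]]

lemma inner_matrix_vector_mult:
  fixes M :: "real^'n^'m"
  shows "x \<bullet> (M *v v) = (transpose M *v x) \<bullet> v"
  by (simp add: dot_lmul_matrix)

text \<open>The simp rule would turn \<open>transpose M *v x\<close> into \<open>x v* M\<close>,
  whereas adjoint operators are kept below in the form \<open>transpose M *v x\<close>.\<close>

declare transpose_matrix_vector [simp del]

lemma bounded_linear_transpose: "bounded_linear (transpose :: real^'n^'m \<Rightarrow> real^'m^'n)"
proof -
  have "linear (transpose :: real^'n^'m \<Rightarrow> real^'m^'n)"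
    by unfold_locales (simp_all add: transpose_def vec_eq_iff)
  then show ?thesis
    by (simp add: linear_conv_bounded_linear)
qed

text \<open>A jump at \<open>0\<close> is allowed so that causal kernels, which vanish on the negative half line, qualify.\<close>

definition kernel :: "(real \<Rightarrow> real^'n^'m) \<Rightarrow> bool" where
  "kernel k \<longleftrightarrow> bounded (range k) \<and> (\<forall>x. x \<noteq> 0 \<longrightarrow> isCont k x)"

text \<open>The kernel of the adjoint operator, see \<open>conv_adjoint\<close>: the matrix is
  transposed and \<open>r\<close>, \<open>s\<close> change roles in
  \<open>k (r - s)\<close>.\<close>

definition reflect :: "(real \<Rightarrow> real^'n^'m) \<Rightarrow> real \<Rightarrow> real^'m^'n" where
  "reflect k t = transpose (k (- t))"

text \<open>The limits are fixed. Volterra integrals up to \<open>r\<close>, or from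
  \<open>r\<close> on, arise from kernels vanishing on a half line, so that forward and backward
  equations share one theory.\<close>

definition conv :: "real \<Rightarrow> real \<Rightarrow> (real \<Rightarrow> real^'n^'m) \<Rightarrow> (real \<Rightarrow> real^'n) \<Rightarrow> real \<Rightarrow> real^'m" where
  "conv a b k f r = (LINT s:{a..b}|lebesgue. k (r - s) *v f s)"

lemma kernel_reflect:
  assumes "kernel k" shows "kernel (reflect k)"
proof -
  have "range (reflect k) = transpose ` range k"
    unfolding reflect_def by (auto simp: image_iff) (metis minus_minus)
  then have "bounded (range (reflect k))"
    using assms bounded_linear_image[OF _ bounded_linear_transpose] by (auto simp: kernel_def)
  moreover have "isCont (reflect k) x" if "x \<noteq> 0" for x
  proof -
    have "isCont k (- x)" using assms that by (simp add: kernel_def)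
    then have "isCont (\<lambda>t. k (- t)) x"
      by (intro isCont_o2[where g = k and f = uminus]) auto
    then show ?thesis
      unfolding reflect_def[abs_def] by (rule bounded_linear.isCont[OF bounded_linear_transpose])
  qed
  ultimately show ?thesis by (simp add: kernel_def)
qed

lemma kernel_borel_measurable:
  assumes "kernel k" shows "k \<in> borel_measurable borel"
  using assms
  by (intro borel_measurable_continuous_countable_exceptions[of "{0}"])
    (auto simp: kernel_def intro!: continuous_at_imp_continuous_on)

lemma kernel_bound:
  assumes "kernel k" obtains c where "c > 0" "\<And>x v. norm (k x *v v) \<le> c * norm v"
proof -
  obtain c where "c > 0" and c: "\<And>x. norm (k x) \<le> c"
    using assms by (auto simp: kernel_def bounded_pos)
  then have "norm (k x *v v) \<le> c * norm v" for x v
    by (meson norm_matrix_vector_mult_le order_trans mult_right_mono norm_ge_zero)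
  with \<open>c > 0\<close> show thesis by (rule that)
qed

lemma kernel_mult_integrable:
  assumes "kernel k" "f absolutely_integrable_on S" "S \<in> sets lebesgue"
  shows "(\<lambda>s. k (r - s) *v f s) absolutely_integrable_on S"
proof (rule absolutely_integrable_bounded_measurable_product[OF bilinear_matrix_vector_mult])
  have "(\<lambda>s. k (r - s)) \<in> borel_measurable borel"
    by (rule measurable_compose[OF _ kernel_borel_measurable[OF assms(1)]]) simp
  then show "(\<lambda>s. k (r - s)) \<in> borel_measurable (lebesgue_on S)"
    by (intro measurable_restrict_space1 measurable_completion) simp
  show "bounded ((\<lambda>s. k (r - s)) ` S)"
    using assms(1) by (auto simp: kernel_def intro: bounded_subset)
qed fact+

text \<open>Dominated convergence: the jump of \<open>k\<close> at \<open>0\<close> is met only for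
  \<open>s = r\<close>, a null set. Convolution thus turns integrable functions into continuous
  ones.\<close>

lemma continuous_on_kernel_integral:
  assumes "kernel k" "f absolutely_integrable_on S" "S \<in> sets lebesgue"
  shows "continuous_on UNIV (\<lambda>r. LINT s:S|lebesgue. k (r - s) *v f s)"
  unfolding continuous_on_sequentially comp_def
proof (intro allI ballI impI, elim conjE)
  fix x and r :: real assume x: "x \<longlonglongrightarrow> r"
  obtain c where c: "c > 0" "\<And>x v. norm (k x *v v) \<le> c * norm v"
    using kernel_bound[OF assms(1)] by blast
  show "(\<lambda>n. LINT s:S|lebesgue. k (x n - s) *v f s) \<longlonglongrightarrow> (LINT s:S|lebesgue. k (r - s) *v f s)"
    unfolding set_lebesgue_integral_def
  proof (rule integral_dominated_convergence[where w = "\<lambda>s. c * norm (indicator S s *\<^sub>R f s)"])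
    show "(\<lambda>s. indicator S s *\<^sub>R (k (r - s) *v f s)) \<in> borel_measurable lebesgue"
      "\<And>i. (\<lambda>s. indicator S s *\<^sub>R (k (x i - s) *v f s)) \<in> borel_measurable lebesgue"
      using kernel_mult_integrable[OF assms] by (auto simp: set_integrable_def)
    show "integrable lebesgue (\<lambda>s. c * norm (indicator S s *\<^sub>R f s))"
      using assms(2) by (intro integrable_mult_right integrable_norm) (simp add: set_integrable_def)
    show "AE s in lebesgue. (\<lambda>i. indicator S s *\<^sub>R (k (x i - s) *v f s))
        \<longlonglongrightarrow> indicator S s *\<^sub>R (k (r - s) *v f s)"
    proof (rule AE_I')
      show "{r} \<in> null_sets lebesgue" by simp
      have "(\<lambda>i. indicator S s *\<^sub>R (k (x i - s) *v f s)) \<longlonglongrightarrow> indicator S s *\<^sub>R (k (r - s) *v f s)"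
        if "s \<noteq> r" for s
      proof -
        have "isCont k (r - s)" using assms(1) that by (simp add: kernel_def)
        then have "(\<lambda>i. k (x i - s)) \<longlonglongrightarrow> k (r - s)"
          by (rule isCont_tendsto_compose) (intro tendsto_intros x)
        then show ?thesis
          by (intro tendsto_intros bounded_bilinear.tendsto[OF bounded_bilinear_matrix_vector_mult])
      qed
      then show "{s \<in> space lebesgue. \<not> (\<lambda>i. indicator S s *\<^sub>R (k (x i - s) *v f s))
        \<longlonglongrightarrow> indicator S s *\<^sub>R (k (r - s) *v f s)} \<subseteq> {r}" by blast
    qed
    show "\<And>i. AE s in lebesgue. norm (indicator S s *\<^sub>R (k (x i - s) *v f s)) \<le> c * norm (indicator S s *\<^sub>R f s)"
      using c by (auto simp: indicator_def)
  qed
qed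

lemma set_integral_norm_bound_le:
  fixes f :: "real \<Rightarrow> 'a::euclidean_space"
  assumes "f absolutely_integrable_on S" "g absolutely_integrable_on S"
    and "\<And>s. s \<in> S \<Longrightarrow> norm (f s) \<le> g s"
  shows "norm (LINT s:S|lebesgue. f s) \<le> (LINT s:S|lebesgue. g s)"
  unfolding set_lebesgue_integral_def
  by (rule Bochner_Integration.integral_norm_bound_integral)
    (use assms in \<open>auto simp: set_integrable_def indicator_def\<close>)

text \<open>Prepares Fubini on \<open>lebesgue \<Otimes>\<^sub>M lebesgue\<close>; a countable cover
  that works for \<open>lborel\<close> also works for its completion.\<close>

lemma sigma_finite_lebesgue: "sigma_finite_measure (lebesgue :: real measure)"
proof
  obtain A :: "real set set" where A: "countable A" "A \<subseteq> sets lborel" "\<Union>A = space lborel"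
      "\<forall>a\<in>A. emeasure lborel a \<noteq> \<infinity>"
    using lborel.sigma_finite_countable by blast
  show "\<exists>A::real set set. countable A \<and> A \<subseteq> sets lebesgue \<and> \<Union>A = space lebesgue
      \<and> (\<forall>a\<in>A. emeasure lebesgue a \<noteq> \<infinity>)"
    using A by (intro exI[of _ A]) (auto simp: emeasure_completion)
qed

text \<open>Fubini's theorem combined with \<open>transpose (k (r - s)) = reflect k (s - r)\<close>.
  This is the source of the adjoint equation.\<close>

lemma conv_adjoint:
  fixes k :: "real \<Rightarrow> real^'n^'m"
  assumes k: "kernel k" and f: "f absolutely_integrable_on {a..b}"
    and g: "g absolutely_integrable_on {a..b}"
  shows "(LINT r:{a..b}|lebesgue. g r \<bullet> conv a b k f r)
       = (LINT s:{a..b}|lebesgue. conv a b (reflect k) g s \<bullet> f s)"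
proof -
  interpret L: sigma_finite_measure "lebesgue :: real measure" by (rule sigma_finite_lebesgue)
  interpret P: pair_sigma_finite "lebesgue :: real measure" "lebesgue :: real measure" ..
  obtain c where c: "c > 0" "\<And>x v. norm (k x *v v) \<le> c * norm v"
    using kernel_bound[OF k] by blast
  define f' where "f' = (\<lambda>s. indicator {a..b} s *\<^sub>R f s)"
  define g' where "g' = (\<lambda>s. indicator {a..b} s *\<^sub>R g s)"
  have f': "integrable lebesgue f'" and g': "integrable lebesgue g'"
    using f g by (auto simp: set_integrable_def f'_def g'_def)
  have [measurable]: "f' \<in> borel_measurable lebesgue" "g' \<in> borel_measurable lebesgue"
    using f' g' by auto
  have [measurable]: "k \<in> borel_measurable borel" by (rule kernel_borel_measurable[OF k])
  have [measurable]: "id \<in> borel_measurable (lebesgue :: real measure)" by simp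
  \<comment> \<open>The product is formed from completed measures, so Borel measurability of the
    projections comes from composing with the identity from \<open>lebesgue\<close> to the Borel
    sets.\<close>
  have [measurable]: "(fst :: real \<times> real \<Rightarrow> real) \<in> borel_measurable (lebesgue \<Otimes>\<^sub>M lebesgue)"
    "(snd :: real \<times> real \<Rightarrow> real) \<in> borel_measurable (lebesgue \<Otimes>\<^sub>M lebesgue)"
    using measurable_compose[OF measurable_fst id_borel_measurable_lebesgue, of lebesgue]
      measurable_compose[OF measurable_snd id_borel_measurable_lebesgue, of lebesgue]
    by (simp_all add: id_def)
  define F where "F = (\<lambda>r s. g' r \<bullet> (k (r - s) *v f' s))"
  have meas: "case_prod F \<in> borel_measurable (lebesgue \<Otimes>\<^sub>M lebesgue)"
  proof -
    have "(\<lambda>p. k (fst p - snd p) *v f' (snd p)) \<in> borel_measurable (lebesgue \<Otimes>\<^sub>M lebesgue)"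
      by (rule borel_measurable_continuous_Pair[where H = "(*v)"])
        (measurable, intro continuous_intros bounded_bilinear.continuous_on[OF bounded_bilinear_matrix_vector_mult])
    then show ?thesis
      unfolding F_def case_prod_beta by measurable
  qed
  have F_le: "norm (F r s) \<le> norm (g' r) * (c * norm (f' s))" for r s
    unfolding F_def real_norm_def
    by (rule order_trans[OF Cauchy_Schwarz_ineq2]) (intro mult_left_mono c(2) norm_ge_zero)
  have intF: "integrable (lebesgue \<Otimes>\<^sub>M lebesgue) (case_prod F)"
  proof (rule Bochner_Integration.integrable_bound)
    show "integrable (lebesgue \<Otimes>\<^sub>M lebesgue) (\<lambda>p. norm (g' (fst p)) * (c * norm (f' (snd p))))"
    proof (rule P.Fubini_integrable)
      show "AE x in lebesgue. integrable lebesgue (\<lambda>y. norm (g' (fst (x, y))) * (c * norm (f' (snd (x, y)))))"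
        using f' by auto
      show "integrable lebesgue
        (\<lambda>x. LINT y|lebesgue. norm (norm (g' (fst (x, y))) * (c * norm (f' (snd (x, y))))))"
        using g' c(1) by (simp add: abs_mult)
    qed measurable
    show "AE p in lebesgue \<Otimes>\<^sub>M lebesgue. norm (case_prod F p)
        \<le> norm (norm (g' (fst p)) * (c * norm (f' (snd p))))"
      using F_le c(1) by (auto intro!: AE_I2 simp: abs_mult)
  qed (rule meas)
  have cv: "conv a b k f r = (LINT s|lebesgue. k (r - s) *v f' s)" for r
    unfolding conv_def set_lebesgue_integral_def f'_def by (simp add: matrix_vector_mult_scaleR)
  have cv': "conv a b (reflect k) g s = (LINT r|lebesgue. transpose (k (r - s)) *v g' r)" for s
    unfolding conv_def set_lebesgue_integral_def g'_def reflect_def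
    by (simp add: matrix_vector_mult_scaleR)
  have i1: "integrable lebesgue (\<lambda>s. k (r - s) *v f' s)" for r
    using kernel_mult_integrable[OF k f, of r]
    by (simp add: set_integrable_def f'_def matrix_vector_mult_scaleR)
  have i2: "integrable lebesgue (\<lambda>r. transpose (k (r - s)) *v g' r)" for s
    using kernel_mult_integrable[OF kernel_reflect[OF k] g, of s]
    by (simp add: set_integrable_def g'_def matrix_vector_mult_scaleR reflect_def)
  have "(LINT r:{a..b}|lebesgue. g r \<bullet> conv a b k f r) = (LINT r|lebesgue. g' r \<bullet> conv a b k f r)"
    by (simp add: set_lebesgue_integral_def g'_def)
  also have "\<dots> = (LINT r|lebesgue. LINT s|lebesgue. F r s)"
    unfolding F_def cv using i1 by simp
  also have "\<dots> = (LINT s|lebesgue. LINT r|lebesgue. F r s)"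
    using P.Fubini_integral[OF intF] by simp
  also have "\<dots> = (LINT s|lebesgue. conv a b (reflect k) g s \<bullet> f' s)"
    unfolding F_def cv' inner_matrix_vector_mult using i2 by simp
  also have "\<dots> = (LINT s:{a..b}|lebesgue. conv a b (reflect k) g s \<bullet> f s)"
    by (simp add: set_lebesgue_integral_def f'_def)
  finally show ?thesis .
qed

section \<open>Volterra equations\<close>

text \<open>Method of continuity: the estimate bounds the inverse at every parameter
  \<open>l\<close> by one constant, so that solvability passes from \<open>l\<close> to
  \<open>l + 1 / m\<close> by a contraction with a step length independent of
  \<open>l\<close>.\<close>

lemma surj_id_plus_by_continuation:
  fixes K :: "'a::{real_normed_vector,complete_space} \<Rightarrow> 'a"
  assumes K: "bounded_linear K"
    and est: "\<And>l u. 0 \<le> l \<Longrightarrow> l \<le> 1 \<Longrightarrow> norm u \<le> c * norm (u + l *\<^sub>R K u)"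
  shows "\<exists>u. u + K u = f"
proof -
  interpret K: bounded_linear K by (rule K)
  obtain B where B: "B > 0" "\<And>u. norm (K u) \<le> norm u * B"
    using K.pos_bounded by blast
  define C where "C = max c 1"
  have C: "C > 0" by (simp add: C_def)
  have est': "norm u \<le> C * norm (u + l *\<^sub>R K u)" if "0 \<le> l" "l \<le> 1" for l u
    using est[OF that, of u] mult_right_mono[of c C "norm (u + l *\<^sub>R K u)"]
    by (simp add: C_def)
  \<comment> \<open>This \<open>m\<close> makes the contraction constant \<open>C * B / m\<close>
    less than 1.\<close>
  obtain m :: nat where m: "C * B < m" using reals_Archimedean2 by blast
  have m0: "real m > 0" using m C B(1) by (meson less_trans mult_pos_pos)
  have "\<forall>f. \<exists>u. u + (real n / m) *\<^sub>R K u = f" if "n \<le> m" for n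
    using that
  proof (induction n)
    case 0
    then show ?case by simp
  next
    case (Suc n)
    define l where "l = real n / m"
    have l: "0 \<le> l" "l \<le> 1" using Suc.prems m0 by (auto simp: l_def)
    obtain R where R: "\<And>g. R g + l *\<^sub>R K (R g) = g"
      using Suc by (auto simp: l_def choice_iff)
    show ?case
    proof
      fix f
      \<comment> \<open>A fixed point of \<open>G\<close> solves the equation at parameter
        \<open>l + 1 / m\<close>: the surplus \<open>(1 / m) *\<^sub>R K u\<close> is moved to the
        right and the equation at \<open>l\<close> is inverted by \<open>R\<close>.\<close>
      define G where "G u = R (f - (1 / m) *\<^sub>R K u)" for u
      have lip: "dist (G u) (G v) \<le> (C * B / m) * dist u v" for u v
      proof -
        have "(G u - G v) + l *\<^sub>R K (G u - G v) = (1 / m) *\<^sub>R K (v - u)"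
          using R[of "f - (1 / m) *\<^sub>R K u"] R[of "f - (1 / m) *\<^sub>R K v"]
          by (simp add: G_def K.diff algebra_simps)
        then have "norm (G u - G v) \<le> C * norm ((1 / m) *\<^sub>R K (v - u))"
          using est'[OF l, of "G u - G v"] by simp
        also have "\<dots> \<le> C * ((1 / m) * (norm (v - u) * B))"
          using C m0 B(2)[of "v - u"] by (simp add: divide_right_mono)
        finally show ?thesis by (simp add: dist_norm norm_minus_commute mult_ac)
      qed
      have "\<exists>!u. G u = u"
        by (rule banach_fix_type[of "C * B / m"]) (use lip m m0 C B in auto)
      then obtain u where u: "G u = u" by blast
      have "u + (real (Suc n) / m) *\<^sub>R K u = u + l *\<^sub>R K u + (1 / m) *\<^sub>R K u"
        by (simp add: l_def add_divide_distrib scaleR_left_distrib)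
      also have "\<dots> = f" using R[of "f - (1 / m) *\<^sub>R K u"] u by (simp add: G_def)
      finally show "\<exists>u. u + (real (Suc n) / m) *\<^sub>R K u = f" by blast
    qed
  qed
  from this[of m] m0 show ?thesis by simp
qed

text \<open>Gronwall through a weighted sup norm: at a maximum point of \<open>g / E\<close> the
  integral term is at most half of the left side and can be absorbed. Leaving \<open>S\<close> and
  \<open>E\<close> open serves both time directions.\<close>

lemma gronwall_weighted:
  fixes g E :: "real \<Rightarrow> real"
  assumes "a \<le> b" and g: "continuous_on {a..b} g" and E: "continuous_on {a..b} E"
    and E1: "\<And>r. r \<in> {a..b} \<Longrightarrow> 1 \<le> E r \<and> E r \<le> e"
    and S: "\<And>r. r \<in> {a..b} \<Longrightarrow> S r \<subseteq> {a..b} \<and> S r \<in> sets lebesgue"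
    and KE: "\<And>r. r \<in> {a..b} \<Longrightarrow> K * (LINT s:S r|lebesgue. E s) \<le> E r / 2"
    and Kg: "\<And>r. r \<in> {a..b} \<Longrightarrow> g r \<le> M + K * (LINT s:S r|lebesgue. g s)"
    and "0 \<le> K" "0 \<le> M" "r \<in> {a..b}"
  shows "g r \<le> 2 * e * M"
proof -
  have "continuous_on {a..b} (\<lambda>r. g r / E r)"
    using E1 by (intro continuous_intros g E) force
  then obtain r0 where r0: "r0 \<in> {a..b}" "\<And>s. s \<in> {a..b} \<Longrightarrow> g s / E s \<le> g r0 / E r0"
    using continuous_attains_sup[of "{a..b}" "\<lambda>r. g r / E r"] \<open>a \<le> b\<close> by auto
  define m where "m = g r0 / E r0"
  have Epos: "E s > 0" if "s \<in> {a..b}" for s using E1[OF that] by linarith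
  have gm: "g s \<le> m * E s" if "s \<in> {a..b}" for s
    using r0(2)[OF that] Epos[OF that] by (simp add: m_def pos_divide_le_eq)
  have ai: "g absolutely_integrable_on S r0" "E absolutely_integrable_on S r0"
    using S[OF r0(1)] absolutely_integrable_continuous_real[OF g] absolutely_integrable_continuous_real[OF E]
    by (auto intro: set_integrable_subset)
  have "m \<le> 2 * M"
  proof (cases "m \<ge> 0")
    case True
    have "(LINT s:S r0|lebesgue. g s) \<le> (LINT s:S r0|lebesgue. m * E s)"
      using ai S[OF r0(1)] gm by (intro set_integral_mono) auto
    then have "K * (LINT s:S r0|lebesgue. g s) \<le> m * (K * (LINT s:S r0|lebesgue. E s))"
      using \<open>0 \<le> K\<close> by (simp add: mult_left_mono mult.left_commute)
    also have "\<dots> \<le> m * (E r0 / 2)" using KE[OF r0(1)] True by (rule mult_left_mono)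
    finally have "g r0 \<le> M + m * (E r0 / 2)" using Kg[OF r0(1)] by linarith
    moreover have "g r0 = m * E r0" using Epos[OF r0(1)] by (simp add: m_def)
    ultimately have "m * E r0 \<le> 2 * M" by simp
    moreover have "m * 1 \<le> m * E r0" using E1[OF r0(1)] True by (intro mult_left_mono) auto
    ultimately show ?thesis by simp
  qed (use \<open>0 \<le> M\<close> in linarith)
  then have "m * E r \<le> 2 * M * E r" using Epos[OF \<open>r \<in> {a..b}\<close>] by (intro mult_right_mono) auto
  also have "\<dots> \<le> 2 * M * e" using E1[OF \<open>r \<in> {a..b}\<close>] \<open>0 \<le> M\<close> by (intro mult_left_mono) auto
  finally show ?thesis using gm[OF \<open>r \<in> {a..b}\<close>] by (simp add: mult_ac)
qed

lemma LINT_FTC: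
  fixes F :: "real \<Rightarrow> real"
  assumes "a \<le> b" "\<And>x. (F has_real_derivative f x) (at x)" "continuous_on {a..b} f"
  shows "(LINT x:{a..b}|lebesgue. f x) = F b - F a"
proof -
  have "(f has_integral F b - F a) {a..b}"
    using assms
    by (intro fundamental_theorem_of_calculus)
      (auto simp: has_real_derivative_iff_has_vector_derivative[symmetric] intro: has_field_derivative_at_within)
  then show ?thesis
    using set_lebesgue_integral_eq_integral(2)[OF absolutely_integrable_continuous_real[OF assms(3)]]
    by (simp add: integral_unique)
qed

text \<open>The weight grows at rate \<open>2 * K\<close> away from the end where \<open>S r\<close>
  degenerates; integrating it over \<open>S r\<close> gains the factor \<open>1 / (2 * K)\<close>,
  which \<open>gronwall_weighted\<close> asks for.\<close>

lemma gronwall_two_sided: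
  fixes g :: "real \<Rightarrow> real"
  assumes "a \<le> b" and g: "continuous_on {a..b} g"
    and S: "S = (\<lambda>r. {a..r}) \<or> S = (\<lambda>r. {r..b})"
    and Kg: "\<And>r. r \<in> {a..b} \<Longrightarrow> g r \<le> M + K * (LINT s:S r|lebesgue. g s)"
    and "0 < K" "0 \<le> M" "r \<in> {a..b}"
  shows "g r \<le> 2 * exp (2 * K * (b - a)) * M"
  using S
proof
  assume S: "S = (\<lambda>r. {a..r})"
  show ?thesis
  proof (rule gronwall_weighted[of a b g "\<lambda>r. exp (2 * K * (r - a))" _ S K])
    fix r assume r: "r \<in> {a..b}"
    have "(LINT s:{a..r}|lebesgue. exp (2 * K * (s - a)))
        = exp (2 * K * (r - a)) / (2 * K) - exp (2 * K * (a - a)) / (2 * K)"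
      using r \<open>0 < K\<close>
      by (intro LINT_FTC[where F = "\<lambda>s. exp (2 * K * (s - a)) / (2 * K)"])
        (auto intro!: derivative_eq_intros continuous_intros)
    then show "K * (LINT s:S r|lebesgue. exp (2 * K * (s - a))) \<le> exp (2 * K * (r - a)) / 2"
      using \<open>0 < K\<close> S by (simp add: field_simps)
  qed (use assms S in \<open>auto intro!: continuous_intros\<close>)
next
  assume S: "S = (\<lambda>r. {r..b})"
  show ?thesis
  proof (rule gronwall_weighted[of a b g "\<lambda>r. exp (2 * K * (b - r))" _ S K])
    fix r assume r: "r \<in> {a..b}"
    have "(LINT s:{r..b}|lebesgue. exp (2 * K * (b - s)))
        = - exp (2 * K * (b - b)) / (2 * K) - - exp (2 * K * (b - r)) / (2 * K)"
      using r \<open>0 < K\<close>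
      by (intro LINT_FTC[where F = "\<lambda>s. - exp (2 * K * (b - s)) / (2 * K)"])
        (auto intro!: derivative_eq_intros continuous_intros)
    then show "K * (LINT s:S r|lebesgue. exp (2 * K * (b - s))) \<le> exp (2 * K * (b - r)) / 2"
      using \<open>0 < K\<close> S by (simp add: field_simps)
  qed (use assms S in \<open>auto intro!: continuous_intros\<close>)
qed

section \<open>Volterra operators on the Banach space of bounded continuous functions\<close>

lemma bcontfun_absolutely_integrable [simp, intro]:
  fixes w :: "real \<Rightarrow>\<^sub>C 'a::euclidean_space"
  shows "apply_bcontfun w absolutely_integrable_on {a..b}"
  by (rule absolutely_integrable_continuous_real) simp

lemma set_integral_bcontfun_le:
  fixes w :: "real \<Rightarrow>\<^sub>C 'a::euclidean_space"
  assumes "a \<le> b"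
  shows "(LINT s:{a..b}|lebesgue. norm (w s)) \<le> (b - a) * norm w"
proof -
  have "(LINT s:{a..b}|lebesgue. norm (w s)) \<le> (LINT s:{a..b}|lebesgue. norm w)"
    by (intro set_integral_mono absolutely_integrable_continuous_real continuous_intros norm_bounded) simp
  also have "\<dots> = (b - a) * norm w" using assms by (simp add: set_integral_const)
  finally show ?thesis .
qed

text \<open>The bound \<open>VS\<close> by integrals over \<open>S r\<close> gives an a priori
  estimate on \<open>[a, b]\<close> by Gronwall; \<open>VI\<close> carries it over to the whole
  line, on which the functions live. Continuation then applies to \<open>- V\<close>.\<close>

lemma volterra_bijective:
  fixes V :: "(real \<Rightarrow>\<^sub>C 'a::euclidean_space) \<Rightarrow> real \<Rightarrow>\<^sub>C 'a"
  assumes V: "bounded_linear V" and ab: "a \<le> b"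
    and S: "S = (\<lambda>r. {a..r}) \<or> S = (\<lambda>r. {r..b})"
    and VS: "\<And>w r. r \<in> {a..b} \<Longrightarrow> norm (V w r) \<le> K * (LINT s:S r|lebesgue. norm (w s))"
    and VI: "\<And>w r. norm (V w r) \<le> K * (LINT s:{a..b}|lebesgue. norm (w s))" and K: "0 < K"
  obtains R where "bounded_linear R" "\<And>f. R f = f + V (R f)" "\<And>u f. u = f + V u \<Longrightarrow> u = R f"
proof -
  interpret V: bounded_linear V by (rule V)
  define c1 where "c1 = 2 * exp (2 * K * (b - a))"
  \<comment> \<open>\<open>c1\<close> is the Gronwall constant on \<open>[a, b]\<close>; inserting
    that bound into \<open>VI\<close> yields the factor \<open>1 + K * ((b - a) * c1)\<close> at
    every point of the line.\<close>
  define c where "c = c1 + (1 + K * ((b - a) * c1))"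
  have c1: "c1 \<ge> 0" by (simp add: c1_def)
  have est: "norm u \<le> c * norm (u + l *\<^sub>R (- V u))" if l: "0 \<le> l" "l \<le> 1" for l u
  proof -
    define f where "f = u + l *\<^sub>R (- V u)"
    have u: "u r = f r + l *\<^sub>R V u r" for r by (simp add: f_def)
    have ur: "norm (u r) \<le> norm f + norm (V u r)" for r
    proof -
      have "norm (u r) \<le> norm (f r) + norm (l *\<^sub>R V u r)" unfolding u[of r] by (rule norm_triangle_ineq)
      also have "\<dots> \<le> norm f + 1 * norm (V u r)"
        using l by (simp only: norm_scaleR) (intro add_mono norm_bounded mult_right_mono, auto)
      finally show ?thesis by simp
    qed
    have uI: "norm (u r) \<le> c1 * norm f" if "r \<in> {a..b}" for r
      unfolding c1_def
    proof (rule gronwall_two_sided[where g = "\<lambda>r. norm (u r)", OF ab _ S _ K])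
      show "norm (u r) \<le> norm f + K * (LINT s:S r|lebesgue. norm (u s))" if "r \<in> {a..b}" for r
        using ur[of r] VS[OF that, of u] by linarith
    qed (use that in \<open>auto intro!: continuous_intros\<close>)
    have "norm (u r) \<le> c * norm f" for r
    proof -
      have "(LINT s:{a..b}|lebesgue. norm (u s)) \<le> (LINT s:{a..b}|lebesgue. c1 * norm f)"
        by (intro set_integral_mono absolutely_integrable_continuous_real continuous_intros uI) simp_all
      also have "\<dots> = (b - a) * (c1 * norm f)" using ab by (simp add: set_integral_const)
      finally have "K * (LINT s:{a..b}|lebesgue. norm (u s)) \<le> K * ((b - a) * (c1 * norm f))"
        using K by simp
      then have "norm (u r) \<le> norm f + K * ((b - a) * (c1 * norm f))"
        using ur[of r] VI[of u r] by linarith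
      moreover have "0 \<le> c1 * norm f" using c1 by simp
      ultimately show ?thesis unfolding c_def by (simp add: algebra_simps)
    qed
    then show ?thesis unfolding f_def by (rule norm_bound)
  qed
  have "\<exists>u. u + - V u = f" for f
    by (rule surj_id_plus_by_continuation[of "\<lambda>u. - V u"]) (use est V bounded_linear_minus in auto)
  then obtain R where R: "\<And>f. R f - V (R f) = f" by (metis add_uminus_conv_diff)
  \<comment> \<open>At \<open>l = 1\<close> the estimate gives uniqueness, hence linearity of the
    chosen solution operator \<open>R\<close>, and also its bound.\<close>
  have est1: "norm u \<le> c * norm (u - V u)" for u using est[of 1 u] by simp
  have inj: "u = v" if "u - V u = v - V v" for u v
    using est1[of "u - v"] that by (simp add: V.diff algebra_simps)
  have "bounded_linear R"
  proof (rule bounded_linear_intro[where K = c])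
    show "R (x + y) = R x + R y" for x y
      by (rule inj) (simp add: R V.add add_diff_add)
    show "R (r *\<^sub>R x) = r *\<^sub>R R x" for r x
      by (rule inj) (simp add: R V.scaleR flip: scaleR_diff_right)
    show "norm (R x) \<le> norm x * c" for x
      using est1[of "R x"] R[of x] by (simp add: mult.commute)
  qed
  moreover have "R f = f + V (R f)" for f using R[of f] by (simp add: algebra_simps)
  moreover have "u = R f" if "u = f + V u" for u f
    by (rule inj) (use R[of f] that in \<open>metis add_diff_cancel_right'\<close>)
  ultimately show thesis by (rule that)
qed

section \<open>Causal kernels and convolution operators\<close>

definition causal :: "(real \<Rightarrow> 'a::zero) \<Rightarrow> real \<Rightarrow> 'a" where
  "causal f t = (if t < 0 then 0 else f t)"

text \<open>The Heaviside function times the identity. On \<open>[a, b]\<close>, convolution with it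
  integrates from \<open>a\<close> to \<open>r\<close>, and convolution with its reflection from
  \<open>r\<close> to \<open>b\<close>.\<close>

abbreviation step :: "real \<Rightarrow> real^'n^'n" where
  "step \<equiv> causal (\<lambda>_. mat 1)"

text \<open>\<open>Bcontfun\<close> is meaningful only on bounded continuous functions;
  \<open>conv_in_bcontfun\<close> provides this whenever \<open>k\<close> is a
  \<open>kernel\<close>.\<close>

definition Conv :: "real \<Rightarrow> real \<Rightarrow> (real \<Rightarrow> real^'n^'m) \<Rightarrow> (real \<Rightarrow>\<^sub>C (real^'n)) \<Rightarrow> real \<Rightarrow>\<^sub>C (real^'m)" where
  "Conv a b k w = Bcontfun (conv a b k (apply_bcontfun w))"

definition Mult :: "real^'n^'m \<Rightarrow> (real \<Rightarrow>\<^sub>C (real^'n)) \<Rightarrow> real \<Rightarrow>\<^sub>C (real^'m)" where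
  "Mult M w = Bcontfun (\<lambda>r. M *v w r)"

lemma kernel_causal:
  assumes "continuous_on UNIV f" "bounded (range f)"
  shows "kernel (causal f)"
proof -
  have "range (causal f) \<subseteq> insert 0 (range f)" by (auto simp: causal_def)
  then have "bounded (range (causal f))" using assms(2) bounded_subset bounded_insert by blast
  moreover have "isCont (causal f) x" if "x \<noteq> 0" for x
  proof (cases "x < 0")
    case True
    have "eventually (\<lambda>t. t < 0) (nhds x)" using True eventually_nhds_in_open[of "{..<0}" x] by simp
    then have "eventually (\<lambda>t. causal f t = 0) (nhds x)" by eventually_elim (simp add: causal_def)
    then show ?thesis by (subst isCont_cong) (assumption, rule continuous_const)
  next
    case False
    then have "eventually (\<lambda>t. t > 0) (nhds x)" using that eventually_nhds_in_open[of "{0<..}" x] by simp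
    then have "eventually (\<lambda>t. causal f t = f t) (nhds x)" by eventually_elim (simp add: causal_def)
    moreover have "isCont f x" using assms(1) by (simp add: continuous_on_eq_continuous_at)
    ultimately show ?thesis using isCont_cong by blast
  qed
  ultimately show ?thesis by (simp add: kernel_def)
qed

lemma kernel_step: "kernel step"
  by (rule kernel_causal) auto

lemma conv_causal:
  assumes "r \<in> {a..b}"
  shows "conv a b (causal k) f r = (LINT s:{a..r}|lebesgue. k (r - s) *v f s)"
  unfolding conv_def set_lebesgue_integral_def
  by (rule Bochner_Integration.integral_cong) (use assms in \<open>auto simp: causal_def indicator_def\<close>)

lemma conv_add:
  assumes "kernel k" "f absolutely_integrable_on {a..b}" "g absolutely_integrable_on {a..b}"
  shows "conv a b k (\<lambda>s. f s + g s) r = conv a b k f r + conv a b k g r"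
  unfolding conv_def by (simp add: matrix_vector_right_distrib kernel_mult_integrable[OF assms(1)] assms)

lemma conv_diff:
  assumes "kernel k" "f absolutely_integrable_on {a..b}" "g absolutely_integrable_on {a..b}"
  shows "conv a b k (\<lambda>s. f s - g s) r = conv a b k f r - conv a b k g r"
  unfolding conv_def by (simp add: matrix_vector_mult_diff_distrib kernel_mult_integrable[OF assms(1)] assms)

lemma conv_scaleR: "conv a b k (\<lambda>s. c *\<^sub>R f s) r = c *\<^sub>R conv a b k f r"
  unfolding conv_def by (simp add: matrix_vector_mult_scaleR)

lemma conv_cong:
  assumes "\<And>s. s \<in> {a..b} \<Longrightarrow> f s = g s"
  shows "conv a b k f = conv a b k g"
  unfolding conv_def using assms by (intro ext set_lebesgue_integral_cong) auto

text \<open>\<open>S\<close> contains the part of \<open>[a, b]\<close> that the kernel sees from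
  \<open>r\<close>. With \<open>{a..r}\<close> or \<open>{r..b}\<close> this becomes the Volterra
  estimate.\<close>

lemma conv_norm_le:
  assumes k: "kernel k" and c: "\<And>x v. norm (k x *v v) \<le> c * norm v"
    and f: "f absolutely_integrable_on {a..b}"
    and S: "S \<subseteq> {a..b}" "S \<in> sets lebesgue" "\<And>s. s \<in> {a..b} - S \<Longrightarrow> k (r - s) = 0"
  shows "norm (conv a b k f r) \<le> c * (LINT s:S|lebesgue. norm (f s))"
proof -
  have f': "f absolutely_integrable_on S" by (rule set_integrable_subset[OF f S(2,1)])
  have "conv a b k f r = (LINT s:S|lebesgue. k (r - s) *v f s)"
    unfolding conv_def set_lebesgue_integral_def
  proof (rule Bochner_Integration.integral_cong)
    fix s show "indicator {a..b} s *\<^sub>R (k (r - s) *v f s) = indicator S s *\<^sub>R (k (r - s) *v f s)"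
      using S(1) S(3)[of s] by (cases "s \<in> S"; cases "s \<in> {a..b}") auto
  qed simp
  also have "norm \<dots> \<le> (LINT s:S|lebesgue. c * norm (f s))"
    using c by (intro set_integral_norm_bound_le kernel_mult_integrable k f' S)
      (auto intro: absolutely_integrable_norm[OF f', unfolded comp_def])
  finally show ?thesis by simp
qed

lemma conv_in_bcontfun:
  assumes k: "kernel k" and f: "f absolutely_integrable_on {a..b}"
  shows "conv a b k f \<in> bcontfun"
proof -
  obtain c where c: "\<And>x v. norm (k x *v v) \<le> c * norm v" using kernel_bound[OF k] by metis
  show ?thesis
  proof (rule bcontfun_normI)
    show "continuous_on UNIV (conv a b k f)"
      unfolding conv_def[abs_def] by (rule continuous_on_kernel_integral[OF k f]) simp
    show "norm (conv a b k f r) \<le> c * (LINT s:{a..b}|lebesgue. norm (f s))" for r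
      by (rule conv_norm_le[OF k c f]) auto
  qed
qed

lemma conv_continuous:
  "kernel k \<Longrightarrow> f absolutely_integrable_on {a..b} \<Longrightarrow> continuous_on X (conv a b k f)"
  using conv_in_bcontfun[where k = k and f = f and a = a and b = b] by (auto simp: bcontfun_def intro: continuous_on_subset)

lemma Conv_apply [simp]: "kernel k \<Longrightarrow> apply_bcontfun (Conv a b k w) = conv a b k w"
  unfolding Conv_def by (intro Bcontfun_inverse conv_in_bcontfun) auto

lemma Mult_apply [simp]: "apply_bcontfun (Mult M w) r = M *v w r"
proof -
  have "(\<lambda>r. M *v w r) \<in> bcontfun"
  proof (rule bcontfun_normI)
    show "norm (M *v w r) \<le> norm M * norm w" for r
      by (rule order_trans[OF norm_matrix_vector_mult_le]) (intro mult_left_mono norm_bounded norm_ge_zero)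
  qed (intro continuous_intros bounded_linear.continuous_on[OF matrix_vector_mul_bounded_linear], simp)
  then show ?thesis by (simp add: Mult_def Bcontfun_inverse)
qed

text \<open>The bound is by an integral instead of a sup norm. It later converts an L2 bound on the
  control into a sup norm bound.\<close>

lemma Conv_norm_le:
  assumes k: "kernel k"
  obtains c where "c > 0" "\<And>w. norm (Conv a b k w) \<le> c * (LINT s:{a..b}|lebesgue. norm (w s))"
proof -
  obtain c where c: "c > 0" "\<And>x v. norm (k x *v v) \<le> c * norm v" using kernel_bound[OF k] by metis
  have "norm (Conv a b k w) \<le> c * (LINT s:{a..b}|lebesgue. norm (w s))" for w
    by (rule norm_bound) (use conv_norm_le[OF k c(2), where f = w and a = a and b = b and S = "{a..b}"] in \<open>simp add: k\<close>)
  with c(1) show thesis by (rule that)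
qed

lemma bounded_linear_Conv:
  assumes k: "kernel k" and ab: "a \<le> b"
  shows "bounded_linear (Conv a b k)"
proof -
  obtain c where c: "c > 0" "\<And>w. norm (Conv a b k w) \<le> c * (LINT s:{a..b}|lebesgue. norm (w s))"
    using Conv_norm_le[OF k, of a b] by blast
  show ?thesis
  proof (rule bounded_linear_intro[where K = "c * (b - a)"])
    show "Conv a b k (u + v) = Conv a b k u + Conv a b k v" for u v
      by (rule bcontfun_eqI) (simp add: k conv_add[symmetric] plus_bcontfun.rep_eq)
    show "Conv a b k (r *\<^sub>R u) = r *\<^sub>R Conv a b k u" for r u
      by (rule bcontfun_eqI) (simp add: k conv_scaleR[symmetric] scaleR_bcontfun.rep_eq)
    show "norm (Conv a b k u) \<le> norm u * (c * (b - a))" for u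
      using order_trans[OF c(2) mult_left_mono[OF set_integral_bcontfun_le[OF ab]]] c(1)
      by (simp add: mult_ac)
  qed
qed

lemma Mult_norm_le: "norm (Mult M w) \<le> norm w * norm M"
  by (rule norm_bound, simp, rule order_trans[OF norm_matrix_vector_mult_le])
    (simp add: mult.commute mult_left_mono norm_bounded)

lemma bounded_linear_Mult: "bounded_linear (Mult M)"
  by (rule bounded_linear_intro[where K = "norm M"])
    (auto intro!: bcontfun_eqI simp: matrix_vector_right_distrib matrix_vector_mult_scaleR Mult_norm_le)

text \<open>With \<open>h\<close> the step kernel or its reflection, the equation is an integrated
  integro-differential equation. The two alternatives of \<open>side\<close> are the forward and the
  backward case.\<close>

lemma volterra_system_bijective:
  fixes A :: "real^'d^'d"
  assumes ab: "a \<le> b" and h: "kernel h" and k: "kernel k"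
    and side: "(\<forall>t<0. h t = 0 \<and> k t = 0) \<or> (\<forall>t>0. h t = 0 \<and> k t = 0)"
  obtains R where "bounded_linear R"
    "\<And>f. R f = f + Conv a b h (Mult A (R f) + Conv a b k (R f))"
    "\<And>u f. u = f + Conv a b h (Mult A u + Conv a b k u) \<Longrightarrow> u = R f"
proof -
  define V where "V w = Conv a b h (Mult A w + Conv a b k w)" for w
  have V: "bounded_linear V"
    unfolding V_def[abs_def]
    by (intro bounded_linear_compose[OF bounded_linear_Conv[OF h ab]] bounded_linear_add
        bounded_linear_Mult bounded_linear_Conv k ab)
  obtain ch where ch: "ch > 0" "\<And>x v. norm (h x *v v) \<le> ch * norm v" using kernel_bound[OF h] by metis
  obtain ck where ck: "ck > 0" "\<And>x v. norm (k x *v v) \<le> ck * norm v" using kernel_bound[OF k] by metis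
  \<comment> \<open>The term \<open>norm A\<close> comes from the multiplication,
    \<open>ck * (b - a)\<close> from the inner convolution under the outer integral; the summand 1
    ensures positivity.\<close>
  define K where "K = ch * (norm A + ck * (b - a) + 1)"
  have K: "0 < K" using ch ck ab by (auto simp: K_def intro!: mult_pos_pos add_nonneg_pos)
  \<comment> \<open>\<open>{c..d}\<close> is a window outside which \<open>w\<close> influences
    neither the outer convolution at \<open>r\<close> nor the inner one on the window. It will be
    \<open>{a..r}\<close>, \<open>{r..b}\<close> or \<open>{a..b}\<close>.\<close>
  have bound: "norm (V w r) \<le> K * (LINT s:{c..d}|lebesgue. norm (w s))"
    if S: "{c..d} \<subseteq> {a..b}" "\<And>s. s \<in> {a..b} - {c..d} \<Longrightarrow> h (r - s) = 0"
      "\<And>q s. q \<in> {c..d} \<Longrightarrow> s \<in> {a..b} - {c..d} \<Longrightarrow> k (q - s) = 0" for w r c d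
  proof -
    define D where "D = (LINT s:{c..d}|lebesgue. norm (w s))"
    have ai: "(\<lambda>s. norm (w s)) absolutely_integrable_on {c..d}"
      by (intro absolutely_integrable_continuous_real continuous_intros) simp
    have D0: "D \<ge> 0" unfolding D_def set_lebesgue_integral_def by (rule integral_nonneg_AE) auto
    have "norm (V w r) \<le> ch * (LINT s:{c..d}|lebesgue. norm ((Mult A w + Conv a b k w) s))"
      unfolding V_def Conv_apply[OF h] by (rule conv_norm_le[OF h ch(2) bcontfun_absolutely_integrable]) (use S in auto)
    also have "\<dots> \<le> ch * (LINT s:{c..d}|lebesgue. norm A * norm (w s) + ck * D)"
    proof (intro mult_left_mono set_integral_mono)
      show "norm ((Mult A w + Conv a b k w) s) \<le> norm A * norm (w s) + ck * D" if "s \<in> {c..d}" for s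
        unfolding D_def plus_bcontfun.rep_eq Conv_apply[OF k] Mult_apply
        by (rule norm_triangle_le, rule add_mono)
          (use that S in \<open>auto intro!: norm_matrix_vector_mult_le conv_norm_le[OF k ck(2)]\<close>)
    qed (use ch in \<open>auto intro!: absolutely_integrable_continuous_real continuous_intros
        bounded_linear.continuous_on[OF matrix_vector_mul_bounded_linear]\<close>)
    also have "\<dots> = ch * (norm A * D + measure lebesgue {c..d} * (ck * D))"
      using ai by (simp add: D_def set_integral_const)
    also have "\<dots> \<le> ch * (norm A * D + (b - a) * (ck * D))"
      using S(1) ab ch ck D0 by (intro mult_left_mono add_mono mult_right_mono) auto
    also have "\<dots> \<le> K * D" using ch D0 by (simp add: K_def algebra_simps)
    finally show ?thesis by (simp add: D_def)
  qed
  define S where "S = (if \<forall>t<0. h t = 0 \<and> k t = 0 then (\<lambda>r. {a..r}) else (\<lambda>r. {r..b}))"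
  obtain R where "bounded_linear R" "\<And>f. R f = f + V (R f)" "\<And>u f. u = f + V u \<Longrightarrow> u = R f"
  proof (rule volterra_bijective[OF V ab, of S K])
    show "S = (\<lambda>r. {a..r}) \<or> S = (\<lambda>r. {r..b})" by (simp add: S_def)
    show "norm (V w r) \<le> K * (LINT s:S r|lebesgue. norm (w s))" if "r \<in> {a..b}" for w r
    proof (cases "\<forall>t<0. h t = 0 \<and> k t = 0")
      case True
      have "norm (V w r) \<le> K * (LINT s:{a..r}|lebesgue. norm (w s))"
        by (rule bound) (use True that in auto)
      then show ?thesis using True by (simp add: S_def)
    next
      case False
      with side have "\<forall>t>0. h t = 0 \<and> k t = 0" by blast
      then have "norm (V w r) \<le> K * (LINT s:{r..b}|lebesgue. norm (w s))"
        by (intro bound) (use that in auto)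
      then show ?thesis by (simp only: S_def if_not_P[OF False])
    qed
    show "norm (V w r) \<le> K * (LINT s:{a..b}|lebesgue. norm (w s))" for w r
      by (rule bound) auto
  qed (use K in auto)
  then show thesis using that unfolding V_def by blast
qed

section \<open>Integrability of products\<close>

lemma inner_absolutely_integrable:
  fixes g \<phi> :: "real \<Rightarrow> real^'n"
  assumes "continuous_on {a..b} \<phi>" "g absolutely_integrable_on {a..b}"
  shows "(\<lambda>s. \<phi> s \<bullet> g s) absolutely_integrable_on {a..b}"
  by (rule absolutely_integrable_bounded_measurable_product[where h = "(\<bullet>)"])
    (use assms in \<open>auto simp: bilinear_conv_bounded_bilinear bounded_bilinear_inner
      intro!: continuous_imp_measurable_on_sets_lebesgue compact_imp_bounded compact_continuous_image\<close>)

lemma mult_absolutely_integrable: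
  fixes M :: "real^'n^'m"
  assumes "g absolutely_integrable_on S"
  shows "(\<lambda>s. M *v g s) absolutely_integrable_on S"
  using absolutely_integrable_linear[OF assms matrix_vector_mul_bounded_linear[of M]]
  by (simp add: comp_def)

section \<open>The linear system with memory\<close>

text \<open>Cauchy-Schwarz in the form that the variance is nonnegative: \<open>\<mu>\<close> is the
  mean of \<open>norm (u s)\<close> over \<open>[a, b]\<close>.\<close>

lemma integral_norm_le_L2:
  fixes u :: "real \<Rightarrow>\<^sub>C 'a::euclidean_space"
  assumes "a < b" and Q: "(LINT s:{a..b}|lebesgue. (norm (u s))\<^sup>2) \<le> (b - a) * m\<^sup>2" and "0 \<le> m"
  shows "(LINT s:{a..b}|lebesgue. norm (u s)) \<le> (b - a) * m"
proof -
  let ?I = "\<lambda>f. LINT s:{a..b}|lebesgue. f s"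
  define D where "D = ?I (\<lambda>s. norm (u s))"
  define \<mu> where "\<mu> = D / (b - a)"
  have ai: "(\<lambda>s. (norm (u s))\<^sup>2) absolutely_integrable_on {a..b}" "(\<lambda>s. norm (u s)) absolutely_integrable_on {a..b}"
    "(\<lambda>s. \<mu>\<^sup>2) absolutely_integrable_on {a..b}"
    by (auto intro!: absolutely_integrable_continuous_real continuous_intros)
  have "0 \<le> ?I (\<lambda>s. (norm (u s) - \<mu>)\<^sup>2)"
    unfolding set_lebesgue_integral_def by (rule integral_nonneg_AE) auto
  also have "\<dots> = ?I (\<lambda>s. (norm (u s))\<^sup>2 - 2 * \<mu> * norm (u s) + \<mu>\<^sup>2)"
    by (simp add: power2_eq_square algebra_simps)
  also have "\<dots> = ?I (\<lambda>s. (norm (u s))\<^sup>2) - 2 * \<mu> * D + (b - a) * \<mu>\<^sup>2"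
    using ai \<open>a < b\<close> by (simp add: D_def set_integral_const)
  also have "\<dots> = ?I (\<lambda>s. (norm (u s))\<^sup>2) - D\<^sup>2 / (b - a)"
  proof -
    have "(b - a) * \<mu>\<^sup>2 = D\<^sup>2 / (b - a)" "2 * \<mu> * D = 2 * (D\<^sup>2 / (b - a))"
      using \<open>a < b\<close> by (simp_all add: \<mu>_def power2_eq_square)
    then show ?thesis by linarith
  qed
  finally have "D\<^sup>2 / (b - a) \<le> (b - a) * m\<^sup>2" using Q by simp
  then have "D\<^sup>2 \<le> ((b - a) * m)\<^sup>2"
    using \<open>a < b\<close> by (simp add: power2_eq_square field_simps)
  then show ?thesis
    using \<open>a < b\<close> \<open>0 \<le> m\<close> by (auto simp: D_def[symmetric] intro: power2_le_imp_le)
qed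

text \<open>The memory kernel is taken on the whole line so that \<open>causal N\<close> is a
  \<open>kernel\<close>. The history before \<open>a\<close> enters only through the inhomogeneity
  \<open>g\<close> of \<open>rhs\<close>.\<close>

locale memory_system =
  fixes A :: "real^'d^'d" and N :: "real \<Rightarrow> real^'d^'d" and a b :: real
  assumes N_continuous: "continuous_on UNIV N" and N_bounded: "bounded (range N)"
    and ab: "a \<le> b"
begin

lemma kernel_N: "kernel (causal N)"
  by (rule kernel_causal[OF N_continuous N_bounded])

definition rhs :: "(real \<Rightarrow> real^'d) \<Rightarrow> (real \<Rightarrow> real^'d) \<Rightarrow> real \<Rightarrow> real^'d" where
  "rhs g w q = A *v w q + conv a b (causal N) w q + g q"

text \<open>The integrated equation, an identity between continuous functions to which the Volterra
  solver applies. \<open>is_solution_iff\<close> links it to Caratheodory solutions.\<close>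

definition sol :: "real^'d \<Rightarrow> (real \<Rightarrow> real^'d) \<Rightarrow> (real \<Rightarrow> real^'d) \<Rightarrow> bool" where
  "sol x g w \<longleftrightarrow> continuous_on {a..b} w \<and> (\<forall>r\<in>{a..b}. w r = x + conv a b step (rhs g w) r)"

lemma forward_solver:
  obtains R where "bounded_linear R"
    "\<And>f. R f = f + Conv a b step (Mult A (R f) + Conv a b (causal N) (R f))"
    "\<And>u f. u = f + Conv a b step (Mult A u + Conv a b (causal N) u) \<Longrightarrow> u = R f"
  by (rule volterra_system_bijective[OF ab kernel_step kernel_N, of A]) (auto simp: causal_def)

text \<open>Reflected kernels vanish for positive arguments, so the second alternative of
  \<open>side\<close> holds: the adjoint equation is solved backwards from \<open>b\<close>.\<close>

lemma backward_solver:
  obtains R where "bounded_linear R"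
    "\<And>f. R f = f + Conv a b (reflect step) (Mult (transpose A) (R f) + Conv a b (reflect (causal N)) (R f))"
  by (rule volterra_system_bijective[OF ab kernel_reflect[OF kernel_step] kernel_reflect[OF kernel_N],
        of "transpose A"])
    (auto simp: causal_def reflect_def transpose_def zero_vec_def)

lemma rhs_integrable:
  assumes "g absolutely_integrable_on {a..b}" "continuous_on {a..b} w"
  shows "rhs g w absolutely_integrable_on {a..b}"
proof -
  have "(\<lambda>q. A *v w q + conv a b (causal N) w q) absolutely_integrable_on {a..b}"
    using assms(2)
    by (intro absolutely_integrable_continuous_real continuous_intros
        bounded_linear.continuous_on[OF matrix_vector_mul_bounded_linear] conv_continuous kernel_N)
  from set_integral_add(1)[OF this assms(1)] show ?thesis by (simp add: rhs_def[abs_def])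
qed

lemma conv_rhs:
  assumes "g absolutely_integrable_on {a..b}"
  shows "conv a b step (rhs g (apply_bcontfun w)) r = conv a b step g r
    + Conv a b step (Mult A w + Conv a b (causal N) w) r"
proof -
  have "conv a b step (rhs g (apply_bcontfun w)) r
      = conv a b step (\<lambda>q. (Mult A w + Conv a b (causal N) w) q + g q) r"
    by (simp add: rhs_def[abs_def] kernel_N plus_bcontfun.rep_eq)
  also have "\<dots> = conv a b step (Mult A w + Conv a b (causal N) w) r + conv a b step g r"
    by (rule conv_add[OF kernel_step bcontfun_absolutely_integrable assms])
  finally show ?thesis by (simp add: kernel_step)
qed

text \<open>Separating the initial value and the integrated \<open>g\<close> as \<open>f\<close>
  brings \<open>sol\<close> into the form \<open>u = f + V u\<close>; the properties of
  \<open>R\<close> then give existence and uniqueness.\<close>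

lemma sol_bcontfun_iff:
  fixes x :: "real^'d"
  assumes g: "g absolutely_integrable_on {a..b}" and R:
    "\<And>f. R f = f + Conv a b step (Mult A (R f) + Conv a b (causal N) (R f))"
    "\<And>u f. u = f + Conv a b step (Mult A u + Conv a b (causal N) u) \<Longrightarrow> u = R f"
  defines "f \<equiv> const_bcontfun x + Bcontfun (conv a b step g)"
  shows "sol x g (apply_bcontfun (R f))" "sol x g w \<Longrightarrow> r \<in> {a..b} \<Longrightarrow> w r = R f r"
proof -
  have f: "f r = x + conv a b step g r" for r
    using conv_in_bcontfun[OF kernel_step g] by (simp add: f_def Bcontfun_inverse plus_bcontfun.rep_eq)
  have "R f r = f r + Conv a b step (Mult A (R f) + Conv a b (causal N) (R f)) r" for r
    by (subst R(1)) (simp only: plus_bcontfun.rep_eq)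
  then have "R f r = x + conv a b step (rhs g (apply_bcontfun (R f))) r" for r
    unfolding conv_rhs[OF g] f by (simp only: add.assoc)
  then show "sol x g (apply_bcontfun (R f))"
    unfolding sol_def using continuous_on_apply_bcontfun by blast
  assume w: "sol x g w" and r: "r \<in> {a..b}"
  have ai: "rhs g w absolutely_integrable_on {a..b}" using g w by (auto simp: sol_def intro: rhs_integrable)
  \<comment> \<open>A solution is prescribed on \<open>[a, b]\<close> only. The right-hand side of
    its own equation extends it to the line, and \<open>conv\<close> does not notice the change
    outside \<open>[a, b]\<close>.\<close>
  define W where "W = const_bcontfun x + Bcontfun (conv a b step (rhs g w))"
  have W: "W r = x + conv a b step (rhs g w) r" for r
    using conv_in_bcontfun[OF kernel_step ai] by (simp add: W_def Bcontfun_inverse plus_bcontfun.rep_eq)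
  have Ww: "W r = w r" if "r \<in> {a..b}" for r using w that by (simp add: W sol_def)
  then have "conv a b (causal N) w = conv a b (causal N) (apply_bcontfun W)"
    by (intro conv_cong) auto
  then have "conv a b step (rhs g w) = conv a b step (rhs g (apply_bcontfun W))"
    by (intro conv_cong) (simp add: rhs_def Ww)
  then have "W = f + Conv a b step (Mult A W + Conv a b (causal N) W)"
    by (intro bcontfun_eqI) (simp add: W f conv_rhs[OF g] plus_bcontfun.rep_eq)
  then have "W = R f" by (rule R(2))
  with Ww[OF r] show "w r = R f r" by simp
qed

lemma sol_exists:
  assumes "g absolutely_integrable_on {a..b}"
  obtains w :: "real \<Rightarrow>\<^sub>C (real^'d)" where "sol x g (apply_bcontfun w)"
proof -
  obtain R where R: "bounded_linear R"
    "\<And>f. R f = f + Conv a b step (Mult A (R f) + Conv a b (causal N) (R f))"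
    "\<And>u f. u = f + Conv a b step (Mult A u + Conv a b (causal N) u) \<Longrightarrow> u = R f"
    by (fact forward_solver)
  show thesis by (rule that, rule sol_bcontfun_iff(1)[OF assms, of R]) (fact R)+
qed

lemma sol_unique:
  assumes "g absolutely_integrable_on {a..b}" "sol x g w" "sol x g w'" "r \<in> {a..b}"
  shows "w r = w' r"
proof -
  obtain R where R: "bounded_linear R"
    "\<And>f. R f = f + Conv a b step (Mult A (R f) + Conv a b (causal N) (R f))"
    "\<And>u f. u = f + Conv a b step (Mult A u + Conv a b (causal N) u) \<Longrightarrow> u = R f"
    by (fact forward_solver)
  have "v r = R (const_bcontfun x + Bcontfun (conv a b step g)) r" if "sol x g v" for v
    by (rule sol_bcontfun_iff(2)[OF assms(1) _ _ that assms(4)]) (fact R)+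
  from this[OF assms(2)] this[OF assms(3)] show ?thesis by simp
qed

lemma rhs_diff:
  assumes "continuous_on {a..b} w" "continuous_on {a..b} w'"
  shows "rhs g w q - rhs g' w' q = rhs (\<lambda>q. g q - g' q) (\<lambda>q. w q - w' q) q"
  using assms
  by (simp add: rhs_def conv_diff[OF kernel_N] absolutely_integrable_continuous_real
      matrix_vector_mult_diff_distrib)

lemma sol_diff:
  assumes "g absolutely_integrable_on {a..b}" "g' absolutely_integrable_on {a..b}"
    and "sol x g w" "sol x' g' w'"
  shows "sol (x - x') (\<lambda>s. g s - g' s) (\<lambda>s. w s - w' s)"
proof -
  have c: "continuous_on {a..b} w" "continuous_on {a..b} w'" using assms by (auto simp: sol_def)
  have "conv a b step (rhs g w) r - conv a b step (rhs g' w') r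
      = conv a b step (rhs (\<lambda>q. g q - g' q) (\<lambda>q. w q - w' q)) r" for r
    using conv_diff[OF kernel_step rhs_integrable[OF assms(1) c(1)] rhs_integrable[OF assms(2) c(2)]]
    by (simp add: rhs_diff[OF c])
  then show ?thesis using assms(3,4) c
    by (auto simp: sol_def algebra_simps intro!: continuous_intros)
qed

text \<open>Integration by parts in integrated form: each operator acting on \<open>z\<close> is
  moved to \<open>p\<close> by \<open>conv_adjoint\<close> or a transpose, and the terms with
  \<open>A\<close> and \<open>N\<close> cancel against those of the adjoint equation.\<close>

lemma adjoint_identity:
  fixes \<phi> p :: "real \<Rightarrow>\<^sub>C (real^'d)"
  assumes g: "g absolutely_integrable_on {a..b}" and z: "sol 0 g z"
    and p: "p = Conv a b (reflect step) \<phi>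
      + Conv a b (reflect step) (Mult (transpose A) p + Conv a b (reflect (causal N)) p)"
  shows "(LINT s:{a..b}|lebesgue. \<phi> s \<bullet> z s) = (LINT s:{a..b}|lebesgue. p s \<bullet> g s)"
proof -
  note kr = kernel_reflect[OF kernel_step]
  have zc: "continuous_on {a..b} z" using z by (simp add: sol_def)
  note za = absolutely_integrable_continuous_real[OF zc]
  note inner = inner_absolutely_integrable[of a b]
  let ?I = "\<lambda>f. LINT s:{a..b}|lebesgue. f s"
  \<comment> \<open>This is minus the derivative of \<open>p\<close> on \<open>[a, b]\<close>, as
    \<open>p\<close> is the integral of \<open>\<psi>\<close> from \<open>s\<close> to
    \<open>b\<close>.\<close>
  define \<psi> where "\<psi> = \<phi> + (Mult (transpose A) p + Conv a b (reflect (causal N)) p)"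
  have "p = Conv a b (reflect step) \<psi>"
    unfolding \<psi>_def
    by (subst linear_add[OF bounded_linear.linear[OF bounded_linear_Conv[OF kr ab]], of \<phi>]) (rule p)
  then have pc: "apply_bcontfun p = conv a b (reflect step) \<psi>" by (simp add: Conv_apply[OF kr])
  have v: "rhs g z absolutely_integrable_on {a..b}" by (rule rhs_integrable[OF g zc])
  have "?I (\<lambda>s. \<psi> s \<bullet> z s) = ?I (\<lambda>s. \<psi> s \<bullet> conv a b step (rhs g z) s)"
    using z by (intro set_lebesgue_integral_cong) (auto simp: sol_def)
  also have "\<dots> = ?I (\<lambda>s. p s \<bullet> rhs g z s)"
    unfolding pc by (rule conv_adjoint[OF kernel_step v bcontfun_absolutely_integrable])
  also have "\<dots> = ?I (\<lambda>s. p s \<bullet> (A *v z s)) + ?I (\<lambda>s. p s \<bullet> conv a b (causal N) z s) + ?I (\<lambda>s. p s \<bullet> g s)"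
    unfolding rhs_def inner_add_right
    using g za by (simp add: inner mult_absolutely_integrable conv_continuous[OF kernel_N za]
        absolutely_integrable_continuous_real)
  also have "?I (\<lambda>s. p s \<bullet> (A *v z s)) = ?I (\<lambda>s. (transpose A *v p s) \<bullet> z s)"
    by (simp only: inner_matrix_vector_mult)
  also have "?I (\<lambda>s. p s \<bullet> conv a b (causal N) z s) = ?I (\<lambda>s. conv a b (reflect (causal N)) p s \<bullet> z s)"
    by (rule conv_adjoint[OF kernel_N za bcontfun_absolutely_integrable])
  finally have 1: "?I (\<lambda>s. \<psi> s \<bullet> z s) = ?I (\<lambda>s. (transpose A *v p s) \<bullet> z s)
    + ?I (\<lambda>s. conv a b (reflect (causal N)) p s \<bullet> z s) + ?I (\<lambda>s. p s \<bullet> g s)" .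
  have c1: "continuous_on {a..b} (\<lambda>s. transpose A *v p s)"
    using continuous_on_apply_bcontfun[of "{a..b}" "Mult (transpose A) p"] by simp
  have c2: "continuous_on {a..b} (conv a b (reflect (causal N)) p)"
    by (rule conv_continuous[OF kernel_reflect[OF kernel_N] bcontfun_absolutely_integrable])
  have "\<psi> s \<bullet> z s = \<phi> s \<bullet> z s + (transpose A *v p s) \<bullet> z s + conv a b (reflect (causal N)) p s \<bullet> z s" for s
    by (simp add: \<psi>_def plus_bcontfun.rep_eq kernel_reflect[OF kernel_N] inner_add_left)
  then have "?I (\<lambda>s. \<psi> s \<bullet> z s) = ?I (\<lambda>s. \<phi> s \<bullet> z s) + ?I (\<lambda>s. (transpose A *v p s) \<bullet> z s)
    + ?I (\<lambda>s. conv a b (reflect (causal N)) p s \<bullet> z s)"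
    by (simp add: inner[OF _ za] c1 c2)
  with 1 show ?thesis by simp
qed

lemma sol_zero: "sol 0 (\<lambda>_. 0) (\<lambda>_. 0)"
  by (simp add: sol_def rhs_def[abs_def] conv_def)

lemma sol_add:
  assumes "g absolutely_integrable_on {a..b}" "g' absolutely_integrable_on {a..b}"
    and "sol x g w" "sol x' g' w'"
  shows "sol (x + x') (\<lambda>s. g s + g' s) (\<lambda>s. w s + w' s)"
proof -
  have 1: "sol (0 - x') (\<lambda>s. 0 - g' s) (\<lambda>s. 0 - w' s)"
    by (rule sol_diff[OF _ assms(2) sol_zero assms(4)]) simp
  have 2: "(\<lambda>s. 0 - g' s) absolutely_integrable_on {a..b}"
    by (rule set_integral_diff(1)[OF absolutely_integrable_zero assms(2)])
  show ?thesis using sol_diff[OF assms(1) 2 assms(3) 1] by simp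
qed

text \<open>The second conclusion says that the first variation of the cost vanishes in every
  direction \<open>h\<close>. By the adjoint identity this amounts to
  \<open>u s = - (transpose B *v p s)\<close>, with \<open>p\<close> the adjoint of the tracking
  error.\<close>

lemma optimal_control_exists:
  fixes B :: "real^'m^'d" and C :: "real^'d^'p" and Y :: "real \<Rightarrow>\<^sub>C (real^'p)"
  assumes "a < b" and g: "g absolutely_integrable_on {a..b}"
  obtains u :: "real \<Rightarrow>\<^sub>C (real^'m)" and w :: "real \<Rightarrow>\<^sub>C (real^'d)"
  where "sol x (\<lambda>s. B *v u s + g s) w"
    "\<And>h z. h absolutely_integrable_on {a..b} \<Longrightarrow> sol 0 (\<lambda>s. B *v h s) z \<Longrightarrow>
      (LINT s:{a..b}|lebesgue. (C *v w s - Y s) \<bullet> (C *v z s)) + (LINT s:{a..b}|lebesgue. u s \<bullet> h s) = 0"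
proof -
  let ?I = "\<lambda>f. LINT s:{a..b}|lebesgue. f s"
  note kr = kernel_reflect[OF kernel_step]
  obtain R where R: "bounded_linear R"
    "\<And>f. R f = f + Conv a b step (Mult A (R f) + Conv a b (causal N) (R f))"
    "\<And>u f. u = f + Conv a b step (Mult A u + Conv a b (causal N) u) \<Longrightarrow> u = R f"
    by (fact forward_solver)
  obtain Q where Q: "bounded_linear Q"
    "\<And>f. Q f = f + Conv a b (reflect step) (Mult (transpose A) (Q f) + Conv a b (reflect (causal N)) (Q f))"
    by (fact backward_solver)
  \<comment> \<open>\<open>Z\<close> is the response to a control from rest without other forcing,
    \<open>P\<close> solves the adjoint equation, and \<open>G (Z u)\<close> is the operator
    \<Lambda> of the introduction.\<close>
  define Z where "Z u = R (Conv a b step (Mult B u))" for u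
  define P where "P \<phi> = Q (Conv a b (reflect step) \<phi>)" for \<phi>
  define G where "G v = Mult (transpose B) (P (Mult (transpose C) (Mult C v)))" for v
  have P_lin: "bounded_linear P"
    unfolding P_def[abs_def] by (intro bounded_linear_compose[OF Q(1)] bounded_linear_Conv kr ab)
  have G_lin: "bounded_linear G"
    unfolding G_def[abs_def]
    by (intro bounded_linear_compose[OF bounded_linear_Mult] bounded_linear_compose[OF P_lin] bounded_linear_Mult)
  have Z_lin: "bounded_linear Z"
    unfolding Z_def[abs_def]
    by (intro bounded_linear_compose[OF R(1)] bounded_linear_compose[OF bounded_linear_Conv[OF kernel_step ab]]
        bounded_linear_Mult)
  interpret P: bounded_linear P by (rule P_lin)
  interpret G: bounded_linear G by (rule G_lin)
  interpret Z: bounded_linear Z by (rule Z_lin)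
  have lam_lin: "bounded_linear (\<lambda>u. G (Z u))" by (rule bounded_linear_compose[OF G_lin Z_lin])
  have Mult_fun: "apply_bcontfun (Mult M v) = (\<lambda>s. M *v v s)" for M :: "real^'i^'j" and v
    by (rule ext) simp
  have Z_sol: "sol 0 (\<lambda>s. B *v u s) (Z u)" for u :: "real \<Rightarrow>\<^sub>C (real^'m)"
  proof -
    have "sol 0 (Mult B u) (R (const_bcontfun 0 + Bcontfun (conv a b step (Mult B u))))"
      by (rule sol_bcontfun_iff(1)) (fact R bcontfun_absolutely_integrable)+
    then show ?thesis by (simp add: Z_def Conv_def Mult_fun)
  qed
  have adj: "?I (\<lambda>s. \<phi> s \<bullet> z s) = ?I (\<lambda>s. P \<phi> s \<bullet> g s)"
    if "g absolutely_integrable_on {a..b}" "sol 0 g z" for \<phi> :: "real \<Rightarrow>\<^sub>C (real^'d)" and g z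
    using Q(2) by (intro adjoint_identity[OF that]) (simp add: P_def)
  have adjB: "?I (\<lambda>s. (C *v v s) \<bullet> (C *v z s)) = ?I (\<lambda>s. G v s \<bullet> h s)"
    if h: "h absolutely_integrable_on {a..b}" and z: "sol 0 (\<lambda>s. B *v h s) z" for h z and v :: "real \<Rightarrow>\<^sub>C (real^'d)"
    using adj[OF mult_absolutely_integrable[OF h] z, of "Mult (transpose C) (Mult C v)"]
    by (simp add: G_def inner_matrix_vector_mult)
  \<comment> \<open>In \<open>adjB\<close> take \<open>h = u\<close> and \<open>v = z = Z u\<close>:
    the pairing becomes the integral of a square.\<close>
  have nonneg: "0 \<le> ?I (\<lambda>s. G (Z u) s \<bullet> u s)" for u :: "real \<Rightarrow>\<^sub>C (real^'m)"
  proof -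
    have "0 \<le> ?I (\<lambda>s. (C *v Z u s) \<bullet> (C *v Z u s))"
      unfolding set_lebesgue_integral_def by (rule integral_nonneg_AE) simp
    then show ?thesis using adjB[OF bcontfun_absolutely_integrable Z_sol, of "Z u" u] by simp
  qed
  obtain cs where cs: "cs > 0" "\<And>w. norm (Conv a b step w :: real \<Rightarrow>\<^sub>C (real^'d)) \<le> cs * ?I (\<lambda>s. norm (w s))"
    using Conv_norm_le[OF kernel_step] by metis
  obtain cG where cG: "cG > 0" "\<And>v. norm (G (R v)) \<le> norm v * cG"
    using bounded_linear.pos_bounded[OF bounded_linear_compose[OF G_lin R(1)]] by blast
  \<comment> \<open>The sup norm of \<open>G (Z u)\<close> is at most \<open>cG * cs\<close> times
    the integral of \<open>norm (Mult B u s)\<close>, which the L2 estimate bounds by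
    \<open>norm B * (b - a)\<close> times the norm of \<open>f\<close>.\<close>
  define c where "c = 1 + cs * (norm B * (b - a)) * cG"
  have est: "norm u \<le> c * norm (u + l *\<^sub>R G (Z u))" if l: "0 \<le> l" "l \<le> 1" for l u
  proof -
    define f where "f = u + l *\<^sub>R G (Z u)"
    have ai: "(\<lambda>s. (norm (u s))\<^sup>2) absolutely_integrable_on {a..b}" "(\<lambda>s. (norm (f s))\<^sup>2) absolutely_integrable_on {a..b}"
      "(\<lambda>s. f s \<bullet> u s) absolutely_integrable_on {a..b}" "(\<lambda>s. G (Z u) s \<bullet> u s) absolutely_integrable_on {a..b}"
      "(\<lambda>s. (norm f)\<^sup>2) absolutely_integrable_on {a..b}"
      by (auto intro!: absolutely_integrable_continuous_real continuous_intros)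
    \<comment> \<open>Pair the equation with \<open>u\<close>: positivity allows the term with
      \<open>l\<close> to be dropped, and Young's inequality then bounds the L2 norm of
      \<open>u\<close> by that of \<open>f\<close>.\<close>
    have "?I (\<lambda>s. f s \<bullet> u s) = ?I (\<lambda>s. (norm (u s))\<^sup>2 + l * (G (Z u) s \<bullet> u s))"
      by (simp add: f_def plus_bcontfun.rep_eq scaleR_bcontfun.rep_eq inner_add_left power2_norm_eq_inner)
    also have "\<dots> = ?I (\<lambda>s. (norm (u s))\<^sup>2) + l * ?I (\<lambda>s. G (Z u) s \<bullet> u s)"
      using ai by simp
    also have "\<dots> \<ge> ?I (\<lambda>s. (norm (u s))\<^sup>2)" using l nonneg[of u] by simp
    finally have 1: "?I (\<lambda>s. (norm (u s))\<^sup>2) \<le> ?I (\<lambda>s. f s \<bullet> u s)" .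
    have "?I (\<lambda>s. f s \<bullet> u s) \<le> ?I (\<lambda>s. (norm (f s))\<^sup>2 / 2 + (norm (u s))\<^sup>2 / 2)"
    proof (intro set_integral_mono ai set_integral_add set_integrable_divide)
      show "f s \<bullet> u s \<le> (norm (f s))\<^sup>2 / 2 + (norm (u s))\<^sup>2 / 2" for s
        using inner_ge_zero[of "f s - u s"]
        by (simp add: power2_norm_eq_inner inner_diff_left inner_diff_right inner_commute)
    qed
    also have "\<dots> = ?I (\<lambda>s. (norm (f s))\<^sup>2) / 2 + ?I (\<lambda>s. (norm (u s))\<^sup>2) / 2" using ai by simp
    finally have "?I (\<lambda>s. (norm (u s))\<^sup>2) \<le> ?I (\<lambda>s. (norm (f s))\<^sup>2)" using 1 by simp
    also have "\<dots> \<le> ?I (\<lambda>s. (norm f)\<^sup>2)"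
      by (intro set_integral_mono ai power_mono norm_bounded norm_ge_zero)
    also have "\<dots> = (b - a) * (norm f)\<^sup>2" using ab by (simp add: set_integral_const)
    finally have u1: "?I (\<lambda>s. norm (u s)) \<le> (b - a) * norm f"
      by (intro integral_norm_le_L2[OF \<open>a < b\<close>]) auto
    have "?I (\<lambda>s. norm (Mult B u s)) \<le> ?I (\<lambda>s. norm B * norm (u s))"
      by (intro set_integral_mono absolutely_integrable_continuous_real continuous_intros)
        (auto intro: norm_matrix_vector_mult_le
          bounded_linear.continuous_on[OF matrix_vector_mul_bounded_linear])
    also have "\<dots> \<le> norm B * ((b - a) * norm f)" using u1 by (simp add: mult_left_mono)
    finally have 2: "norm (Conv a b step (Mult B u)) \<le> cs * (norm B * ((b - a) * norm f))"
      using order_trans[OF cs(2)[of "Mult B u"]] cs(1) by simp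
    have "norm (G (Z u)) \<le> cs * (norm B * ((b - a) * norm f)) * cG"
      unfolding Z_def using order_trans[OF cG(2) mult_right_mono[OF 2]] cG(1) by simp
    moreover have "norm (l *\<^sub>R G (Z u)) \<le> norm (G (Z u))" using l by (simp add: mult_left_le_one_le)
    moreover have "norm u \<le> norm f + norm (l *\<^sub>R G (Z u))"
      unfolding f_def by (metis add_diff_cancel_right' norm_triangle_ineq4)
    ultimately show ?thesis unfolding f_def[symmetric] c_def by (simp add: algebra_simps)
  qed
  obtain w0 :: "real \<Rightarrow>\<^sub>C (real^'d)" where w0: "sol x g w0" by (rule sol_exists[OF g])
  \<comment> \<open>This is the optimality condition for the state \<open>w0 + Z u\<close>, where
    \<open>w0\<close> is the uncontrolled state, with all terms in \<open>u\<close> collected on the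
    left.\<close>
  obtain u where u: "u + G (Z u) = - Mult (transpose B) (P (Mult (transpose C) (Mult C w0 - Y)))"
    using surj_id_plus_by_continuation[OF lam_lin est] by blast
  define w where "w = w0 + Z u"
  define p where "p = P (Mult (transpose C) (Mult C w - Y))"
  have "Mult C w - Y = (Mult C w0 - Y) + Mult C (Z u)"
    by (rule bcontfun_eqI) (simp add: w_def plus_bcontfun.rep_eq minus_bcontfun.rep_eq matrix_vector_right_distrib)
  then have "Mult (transpose B) p = Mult (transpose B) (P (Mult (transpose C) (Mult C w0 - Y))) + G (Z u)"
    by (simp only: p_def G_def P.add linear_add[OF bounded_linear.linear[OF bounded_linear_Mult]])
  with u[folded eq_diff_eq] have "u = - Mult (transpose B) p" by simp
  then have up: "u s = - (transpose B *v p s)" for s by (simp add: uminus_bcontfun.rep_eq)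
  show thesis
  proof (rule that)
    have "sol (0 + x) (\<lambda>s. B *v u s + g s) (\<lambda>s. Z u s + w0 s)"
      by (intro sol_add mult_absolutely_integrable bcontfun_absolutely_integrable g Z_sol w0)
    then show "sol x (\<lambda>s. B *v u s + g s) w" by (simp add: w_def plus_bcontfun.rep_eq[abs_def] add.commute)
    fix h z assume h: "h absolutely_integrable_on {a..b}" and z: "sol 0 (\<lambda>s. B *v h s) z"
    have "?I (\<lambda>s. (C *v w s - Y s) \<bullet> (C *v z s)) = ?I (\<lambda>s. p s \<bullet> (B *v h s))"
      using adj[OF mult_absolutely_integrable[OF h] z, of "Mult (transpose C) (Mult C w - Y)"]
      by (simp add: p_def minus_bcontfun.rep_eq inner_matrix_vector_mult)
    also have "\<dots> = - ?I (\<lambda>s. u s \<bullet> h s)"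
      using set_integral_uminus[OF inner_absolutely_integrable[OF continuous_on_apply_bcontfun h, of u]]
      by (simp add: inner_matrix_vector_mult up)
    finally show "?I (\<lambda>s. (C *v w s - Y s) \<bullet> (C *v z s)) + ?I (\<lambda>s. u s \<bullet> h s) = 0" by simp
  qed
qed

end

section \<open>Solutions and their restarts\<close>

lemma LINT_cong_AE:
  fixes f g :: "real \<Rightarrow> 'a::euclidean_space"
  assumes "f absolutely_integrable_on S" "g absolutely_integrable_on S"
    and "AE x in lebesgue. x \<in> S \<longrightarrow> f x = g x"
  shows "(LINT x:S|lebesgue. f x) = (LINT x:S|lebesgue. g x)"
  unfolding set_lebesgue_integral_def
  by (rule integral_cong_AE) (use assms in \<open>auto simp: set_integrable_def indicator_def\<close>)

lemma LINT_split:
  fixes f :: "real \<Rightarrow> 'a::euclidean_space"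
  assumes "f absolutely_integrable_on {a..b}" "c \<in> {a..b}"
  shows "(LINT x:{a..b}|lebesgue. f x) = (LINT x:{a..c}|lebesgue. f x) + (LINT x:{c..b}|lebesgue. f x)"
proof -
  have "{a..b} = {a..c} \<union> {c..b}" using assms(2) by auto
  moreover have "AE x in lebesgue. \<not> (x \<in> {a..c} \<and> x \<in> {c..b})"
    by (rule AE_I'[of "{c}"]) auto
  ultimately show ?thesis
    using set_integral_Un_AE[of "{a..c}" "{c..b}" lebesgue f]
      set_integrable_subset[OF assms(1), of "{a..c}"] set_integrable_subset[OF assms(1), of "{c..b}"] assms(2)
    by simp
qed

lemma AE_not_endpoint: "AE x in lebesgue. x \<noteq> (c::real)"
  by (rule AE_I'[of "{c}"]) auto

text \<open>On a set of finite measure the function is dominated by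
  \<open>1 + (norm (f s))\<^sup>2\<close>.\<close>

lemma L2_on_imp_absolutely_integrable:
  fixes f :: "real \<Rightarrow> real^'n"
  assumes "L2_on S f" "S \<in> lmeasurable"
  shows "f absolutely_integrable_on S"
proof (rule set_integrable_bound)
  show "(\<lambda>s. 1 + (norm (f s))\<^sup>2) absolutely_integrable_on S"
    using assms by (intro set_integral_add(1) absolutely_integrable_on_const) (auto simp: L2_on_def)
  show "AE x in lebesgue. x \<in> S \<longrightarrow> norm (f x) \<le> norm (1 + (norm (f x))\<^sup>2)"
  proof (intro AE_I2 impI)
    fix x
    have "0 \<le> (norm (f x) - 1)\<^sup>2" by simp
    then have "2 * norm (f x) \<le> 1 + (norm (f x))\<^sup>2" by (simp add: power2_eq_square algebra_simps)
    moreover have "0 \<le> norm (f x)" by simp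
    ultimately have "norm (f x) \<le> 1 + (norm (f x))\<^sup>2" by linarith
    then show "norm (f x) \<le> norm (1 + (norm (f x))\<^sup>2)" by simp
  qed
qed (use assms in \<open>simp add: L2_on_def\<close>)

lemma L2_on_Ioo:
  assumes "L2_on {a<..<b} f"
  shows "f absolutely_integrable_on {a..b}" "(\<lambda>s. (norm (f s))\<^sup>2) absolutely_integrable_on {a..b}"
  unfolding absolutely_integrable_on_Icc_iff_Ioo
  using L2_on_imp_absolutely_integrable[OF assms lmeasurable_interval(2)] assms
  by (simp_all only: L2_on_def)

text \<open>Replaces the measurability clause by integrability, so that the closure rules for
  integrable functions apply.\<close>

lemma L2_on_iff:
  fixes f :: "real \<Rightarrow> real^'n"
  assumes "S \<in> lmeasurable"
  shows "L2_on S f \<longleftrightarrow> f absolutely_integrable_on S \<and> (\<lambda>s. (norm (f s))\<^sup>2) absolutely_integrable_on S"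
proof
  assume "L2_on S f"
  with L2_on_imp_absolutely_integrable[OF this assms]
  show "f absolutely_integrable_on S \<and> (\<lambda>s. (norm (f s))\<^sup>2) absolutely_integrable_on S"
    by (simp only: L2_on_def)
next
  assume f: "f absolutely_integrable_on S \<and> (\<lambda>s. (norm (f s))\<^sup>2) absolutely_integrable_on S"
  then have "set_borel_measurable lebesgue S f"
    unfolding set_integrable_def set_borel_measurable_def by (blast intro: borel_measurable_integrable)
  with f show "L2_on S f" by (simp only: L2_on_def)
qed

lemma L2_on_continuous:
  fixes f :: "real \<Rightarrow> real^'n"
  assumes "continuous_on {a..b} f"
  shows "L2_on {a<..<b} f"
  unfolding L2_on_iff[OF lmeasurable_interval(2)] absolutely_integrable_on_Icc_iff_Ioo[symmetric]
  using assms by (intro conjI absolutely_integrable_continuous_real continuous_intros)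

lemma L2_on_Un:
  assumes "L2_on S f" "L2_on S' f" "S \<in> lmeasurable" "S' \<in> lmeasurable"
  shows "L2_on (S \<union> S') f"
  using assms(1,2)
  unfolding L2_on_iff[OF assms(3)] L2_on_iff[OF assms(4)] L2_on_iff[OF fmeasurable.Un[OF assms(3,4)]]
  by (elim conjE, intro conjI set_integrable_Un fmeasurableD assms)

lemma L2_on_subset:
  assumes "L2_on S f" "S \<in> lmeasurable" "S' \<in> lmeasurable" "S' \<subseteq> S"
  shows "L2_on S' f"
  using assms(1) unfolding L2_on_iff[OF assms(2)] L2_on_iff[OF assms(3)]
  by (elim conjE, intro conjI; elim set_integrable_subset[OF _ fmeasurableD[OF assms(3)] assms(4)])

lemma L2_on_cong:
  assumes "\<And>x. x \<in> S \<Longrightarrow> f x = g x"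
  shows "L2_on S f \<longleftrightarrow> L2_on S g"
proof -
  have "(\<lambda>x. indicator S x *\<^sub>R f x) = (\<lambda>x. indicator S x *\<^sub>R g x)"
    "(\<lambda>x. indicator S x *\<^sub>R (norm (f x))\<^sup>2) = (\<lambda>x. indicator S x *\<^sub>R (norm (g x))\<^sup>2)"
    using assms by (auto simp: fun_eq_iff split: split_indicator)
  then show ?thesis by (simp add: L2_on_def set_borel_measurable_def set_integrable_def)
qed

text \<open>\<open>N'\<close> is a bounded continuous extension of \<open>N\<close> from \<open>[0, T]\<close> to the real line.\<close>

locale lq_problem =
  fixes A :: "real^'d^'d" and B :: "real^'m^'d" and C :: "real^'d^'p"
    and N N' :: "real \<Rightarrow> real^'d^'d" and y :: "real \<Rightarrow> real^'p" and T :: real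
  assumes T: "0 < T" and y_continuous: "continuous_on {0..T} y"
    and N'_continuous: "continuous_on UNIV N'" and N'_bounded: "bounded (range N')"
    and N'_eq: "\<And>t. t \<in> {0..T} \<Longrightarrow> N' t = N t"
begin

text \<open>Written with \<open>N'\<close> to be continuous for all \<open>r\<close>; where the
  equation is imposed it agrees with the integral over \<open>N\<close>.\<close>

definition memory :: "real \<Rightarrow> (real^'d) \<times> (real \<Rightarrow> real^'d) \<Rightarrow> real \<Rightarrow> real^'d" where
  "memory \<tau> \<Xi> r = (LINT s:{0<..<\<tau>}|lebesgue. N' (r - s) *v snd \<Xi> s)"

abbreviation "is_sol \<equiv> is_solution A B N"
abbreviation "sol \<tau> e \<equiv> memory_system.sol A N' \<tau> e"
abbreviation "force \<tau> \<Xi> u \<equiv> (\<lambda>r. B *v u r + memory \<tau> \<Xi> r)"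

lemma memory_system: "\<tau> \<le> e \<Longrightarrow> memory_system N' \<tau> e"
  by unfold_locales (use N'_continuous N'_bounded in auto)

lemma kernel_N': "kernel N'"
  using N'_continuous N'_bounded by (auto simp: kernel_def continuous_on_eq_continuous_at)

lemma M2_integrable: "\<Xi> \<in> M2 \<tau> \<Longrightarrow> snd \<Xi> absolutely_integrable_on {0<..<\<tau>}"
  by (auto simp: M2_def intro: L2_on_imp_absolutely_integrable)

lemma memory_continuous: "\<Xi> \<in> M2 \<tau> \<Longrightarrow> continuous_on S (memory \<tau> \<Xi>)"
  unfolding memory_def[abs_def]
  by (rule continuous_on_subset[OF continuous_on_kernel_integral[OF kernel_N' M2_integrable]]) auto

lemma force_integrable:
  assumes "\<Xi> \<in> M2 \<tau>" "u absolutely_integrable_on {\<tau>..e}"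
  shows "force \<tau> \<Xi> u absolutely_integrable_on {\<tau>..e}"
  by (intro set_integral_add(1) mult_absolutely_integrable assms
      absolutely_integrable_continuous_real memory_continuous)

text \<open>All arguments \<open>q - s\<close> lie in \<open>[0, T]\<close>, where the extension
  \<open>N'\<close> agrees with \<open>N\<close>.\<close>

lemma rhs_eq:
  assumes "0 \<le> \<tau>" "e \<le> T" "q \<in> {\<tau>..e}"
  shows "memory_system.rhs A N' \<tau> e (force \<tau> \<Xi> u) w q
    = A *v w q + (LINT s:{\<tau>..q}|lebesgue. N (q - s) *v w s) + B *v u q
      + (LINT s:{0<..<\<tau>}|lebesgue. N (q - s) *v snd \<Xi> s)"
proof -
  interpret S: memory_system A N' \<tau> e by (rule memory_system) (use assms in auto)
  have "(LINT s:{\<tau>..q}|lebesgue. N' (q - s) *v w s) = (LINT s:{\<tau>..q}|lebesgue. N (q - s) *v w s)"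
    using assms by (intro set_lebesgue_integral_cong) (auto simp: N'_eq)
  moreover have "memory \<tau> \<Xi> q = (LINT s:{0<..<\<tau>}|lebesgue. N (q - s) *v snd \<Xi> s)"
    unfolding memory_def using assms by (intro set_lebesgue_integral_cong) (auto simp: N'_eq)
  ultimately show ?thesis
    unfolding S.rhs_def conv_causal[OF assms(3)] by simp
qed

lemma is_solution_iff:
  assumes "0 \<le> \<tau>" "\<tau> \<le> e" "e \<le> T" "\<Xi> \<in> M2 \<tau>" "u absolutely_integrable_on {\<tau>..e}"
  shows "is_sol e \<tau> \<Xi> u w \<longleftrightarrow> sol \<tau> e (fst \<Xi>) (force \<tau> \<Xi> u) w"
proof
  interpret S: memory_system A N' \<tau> e by (rule memory_system) fact
  let ?rhs = "S.rhs (force \<tau> \<Xi> u) w"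
  have step: "conv \<tau> e step f r = (LINT q:{\<tau>..r}|lebesgue. f q)" if "r \<in> {\<tau>..e}" for f :: "real \<Rightarrow> real^'d" and r
    unfolding conv_causal[OF that] by simp
  note g = force_integrable[OF assms(4,5)]
  {
    assume "is_sol e \<tau> \<Xi> u w"
    then obtain w' where w': "w \<tau> = fst \<Xi>" "has_ae_derivative_on w w' \<tau> e"
      and "AE r in lebesgue. r \<in> {\<tau>..e} \<longrightarrow>
           w' r = A *v w r + (LINT s:{\<tau>..r}|lebesgue. N (r - s) *v w s) + B *v u r
                  + (LINT s:{0<..<\<tau>}|lebesgue. N (r - s) *v snd \<Xi> s)"
      unfolding is_solution_def by (elim conjE exE)
    from this(3) have AE: "AE r in lebesgue. r \<in> {\<tau>..e} \<longrightarrow> w' r = ?rhs r"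
      by (rule AE_mp) (intro AE_I2 impI, simp only: rhs_eq[OF assms(1,3)])
    have ai: "w' absolutely_integrable_on {\<tau>..e}" and w: "\<And>r. r \<in> {\<tau>..e} \<Longrightarrow> w r = w \<tau> + conv \<tau> e step w' r"
      using w'(2)[unfolded has_ae_derivative_on_def, THEN conjunct1]
        bspec[OF w'(2)[unfolded has_ae_derivative_on_def, THEN conjunct2]] by (simp_all only: step)
    have "continuous_on {\<tau>..e} (\<lambda>r. w \<tau> + conv \<tau> e step w' r)"
      by (intro continuous_intros conv_continuous kernel_step ai)
    \<comment> \<open>Continuity of \<open>w\<close> has to come first, from its representation by
      \<open>w'\<close>: it makes \<open>?rhs\<close> integrable.\<close>
    then have wc: "continuous_on {\<tau>..e} w" by (rule continuous_on_eq) (rule w[symmetric])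
    have eq: "conv \<tau> e step w' r = conv \<tau> e step ?rhs r" if "r \<in> {\<tau>..e}" for r
      unfolding step[OF that]
    proof (rule LINT_cong_AE)
      show "w' absolutely_integrable_on {\<tau>..r}" "?rhs absolutely_integrable_on {\<tau>..r}"
        using set_integrable_subset[OF ai, of "{\<tau>..r}"] that
          set_integrable_subset[OF S.rhs_integrable[OF g wc], of "{\<tau>..r}"] by simp_all
      show "AE x in lebesgue. x \<in> {\<tau>..r} \<longrightarrow> w' x = ?rhs x"
        using AE by eventually_elim (use that in auto)
    qed
    show "sol \<tau> e (fst \<Xi>) (force \<tau> \<Xi> u) w"
      unfolding S.sol_def
    proof (intro conjI ballI wc)
      show "w r = fst \<Xi> + conv \<tau> e step ?rhs r" if "r \<in> {\<tau>..e}" for r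
        by (rule w[OF that, unfolded w'(1) eq[OF that]])
    qed
  }
  {
    assume w: "sol \<tau> e (fst \<Xi>) (force \<tau> \<Xi> u) w"
    then have wc: "continuous_on {\<tau>..e} w" by (simp add: S.sol_def)
    have w\<tau>: "w \<tau> = fst \<Xi>"
    proof -
      have "(LINT q:{\<tau>..\<tau>}|lebesgue. ?rhs q) = 0"
        unfolding set_lebesgue_integral_def
        by (rule integral_eq_zero_AE, rule AE_mp[OF AE_not_endpoint[of \<tau>]]) (auto intro!: AE_I2)
      moreover have "w \<tau> = fst \<Xi> + conv \<tau> e step ?rhs \<tau>" using w assms(2) by (simp add: S.sol_def)
      ultimately show ?thesis using step[of \<tau> ?rhs] assms(2) by simp
    qed
    have "has_ae_derivative_on w ?rhs \<tau> e"
      unfolding has_ae_derivative_on_def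
    proof (intro conjI ballI S.rhs_integrable g wc)
      show "w r = w \<tau> + (LINT q:{\<tau>..r}|lebesgue. ?rhs q)" if "r \<in> {\<tau>..e}" for r
        using w that unfolding S.sol_def w\<tau> step[OF that, symmetric] by blast
    qed
    with w\<tau> show "is_sol e \<tau> \<Xi> u w"
      unfolding is_solution_def
      by (intro conjI exI[of _ ?rhs] AE_I2 impI) (simp_all only: rhs_eq[OF assms(1,3)])
  }
qed

lemma is_sol_exists:
  assumes "0 \<le> \<tau>" "\<tau> \<le> e" "e \<le> T" "\<Xi> \<in> M2 \<tau>" "u absolutely_integrable_on {\<tau>..e}"
  shows "\<exists>w. is_sol e \<tau> \<Xi> u w"
proof -
  interpret S: memory_system A N' \<tau> e by (rule memory_system) fact
  obtain w where "sol \<tau> e (fst \<Xi>) (force \<tau> \<Xi> u) (apply_bcontfun w)"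
    by (rule S.sol_exists[OF force_integrable[OF assms(4,5)]])
  then show ?thesis using is_solution_iff[OF assms] by blast
qed

lemma is_sol_unique:
  assumes "0 \<le> \<tau>" "\<tau> \<le> e" "e \<le> T" "\<Xi> \<in> M2 \<tau>" "u absolutely_integrable_on {\<tau>..e}"
    and "is_sol e \<tau> \<Xi> u w" "is_sol e \<tau> \<Xi> u v" "r \<in> {\<tau>..e}"
  shows "w r = v r"
proof -
  interpret S: memory_system A N' \<tau> e by (rule memory_system) fact
  show ?thesis
    using S.sol_unique[OF force_integrable[OF assms(4,5)] _ _ assms(8)] assms(6,7)
      is_solution_iff[OF assms(1-5)] by blast
qed

lemma is_sol_continuous:
  assumes "0 \<le> \<tau>" "\<tau> \<le> e" "e \<le> T" "\<Xi> \<in> M2 \<tau>" "u absolutely_integrable_on {\<tau>..e}"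
    and "is_sol e \<tau> \<Xi> u w"
  shows "continuous_on {\<tau>..e} w"
  using assms(6) unfolding is_solution_iff[OF assms(1-5)]
  by (simp add: memory_system.sol_def[OF memory_system[OF assms(2)]])

text \<open>\<open>traj\<close> selects some solution; by uniqueness on \<open>[\<tau>, e]\<close>
  any given solution \<open>w\<close> may stand for it.\<close>

lemma traj_eq:
  assumes "0 \<le> \<tau>" "\<tau> \<le> e" "e \<le> T" "\<Xi> \<in> M2 \<tau>" "u absolutely_integrable_on {\<tau>..e}"
    and "is_sol e \<tau> \<Xi> u w" "r \<le> e"
  shows "traj A B N e \<tau> \<Xi> u r = (if r < \<tau> then snd \<Xi> r else w r)"
proof -
  have "is_sol e \<tau> \<Xi> u (SOME w. is_sol e \<tau> \<Xi> u w)" 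
    using someI[of "is_sol e \<tau> \<Xi> u", OF assms(6)] .
  then show ?thesis using is_sol_unique[OF assms(1-5) _ assms(6), of _ r] assms(7) by (auto simp: traj_def)
qed

text \<open>The equation is imposed almost everywhere, so the controls may differ at
  \<open>t\<close>. This makes gluing at \<open>t\<close> possible.\<close>

lemma is_sol_restrict:
  assumes w: "is_sol e \<tau> \<Xi> u w" and "t \<le> e" "\<And>r. r \<in> {\<tau>..<t} \<Longrightarrow> u' r = u r"
  shows "is_sol t \<tau> \<Xi> u' w"
proof -
  let ?h = "\<lambda>r. A *v w r + (LINT s:{\<tau>..r}|lebesgue. N (r - s) *v w s)"
  let ?m = "\<lambda>r. LINT s:{0<..<\<tau>}|lebesgue. N (r - s) *v snd \<Xi> s"
  obtain w' where w': "w \<tau> = fst \<Xi>" "has_ae_derivative_on w w' \<tau> e"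
    "AE r in lebesgue. r \<in> {\<tau>..e} \<longrightarrow> w' r = ?h r + B *v u r + ?m r"
    using w unfolding is_solution_def by (elim conjE exE)
  have "has_ae_derivative_on w w' \<tau> t"
    unfolding has_ae_derivative_on_def
  proof (intro conjI ballI)
    show "w' absolutely_integrable_on {\<tau>..t}"
      using w'(2) \<open>t \<le> e\<close> unfolding has_ae_derivative_on_def
      by (elim conjE) (erule set_integrable_subset, auto)
    show "w r = w \<tau> + (LINT q:{\<tau>..r}|lebesgue. w' q)" if "r \<in> {\<tau>..t}" for r
      using w'(2) \<open>t \<le> e\<close> that unfolding has_ae_derivative_on_def by (meson atLeastAtMost_iff order_trans)
  qed
  moreover have "AE r in lebesgue. r \<in> {\<tau>..t} \<longrightarrow> w' r = ?h r + B *v u' r + ?m r"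
    using w'(3) AE_not_endpoint[of t] by eventually_elim (use assms(2,3) in auto)
  ultimately show ?thesis using w'(1) unfolding is_solution_def by (intro conjI exI[of _ w'])
qed

text \<open>The state built from an explicit solution \<open>w\<close>, free of the choice made in
  \<open>traj\<close>.\<close>

definition state_of :: "real \<Rightarrow> (real^'d) \<times> (real \<Rightarrow> real^'d) \<Rightarrow> (real \<Rightarrow> real^'d) \<Rightarrow> real
    \<Rightarrow> (real^'d) \<times> (real \<Rightarrow> real^'d)" where
  "state_of \<tau> \<Xi> w t = (w t, \<lambda>s. if s \<in> {0<..<t} then if s < \<tau> then snd \<Xi> s else w s else 0)"

lemma state_eq:
  assumes "0 \<le> \<tau>" "\<tau> \<le> e" "e \<le> T" "\<Xi> \<in> M2 \<tau>" "u absolutely_integrable_on {\<tau>..e}"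
    and "is_sol e \<tau> \<Xi> u w" "t \<in> {\<tau>..e}"
  shows "state A B N e \<tau> \<Xi> u t = state_of \<tau> \<Xi> w t"
  using traj_eq[OF assms(1-6)] assms(7) by (auto simp: state_def state_of_def)

lemma state_of_in_M2:
  assumes "0 \<le> \<tau>" "\<Xi> \<in> M2 \<tau>" "continuous_on {\<tau>..t} w" "\<tau> \<le> t"
  shows "state_of \<tau> \<Xi> w t \<in> M2 t"
proof -
  let ?f = "snd (state_of \<tau> \<Xi> w t)"
  have 1: "L2_on {0<..<\<tau>} ?f"
    using assms(2,4) by (subst L2_on_cong[of _ _ "snd \<Xi>"]) (auto simp: M2_def state_of_def)
  have 2: "L2_on {\<tau><..<t} ?f"
    using L2_on_continuous[OF assms(3)] assms(1) by (subst L2_on_cong[of _ _ w]) (auto simp: state_of_def)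
  \<comment> \<open>The junction \<open>\<tau>\<close> lies in neither open interval; it is a
    separate, negligible piece, empty if \<open>\<tau> = 0\<close>.\<close>
  have neg: "negligible ({\<tau>} \<inter> {0<..<t})" by (rule negligible_subset[of "{\<tau>}"]) auto
  have 3: "L2_on ({\<tau>} \<inter> {0<..<t}) ?f"
    unfolding L2_on_iff[OF neg[THEN negligible_imp_measurable]]
    by (intro conjI absolutely_integrable_negligible neg)
  have "{0<..<t} = {0<..<\<tau>} \<union> ({\<tau>} \<inter> {0<..<t}) \<union> {\<tau><..<t}" using assms(1,4) by auto
  moreover have "L2_on ({0<..<\<tau>} \<union> ({\<tau>} \<inter> {0<..<t}) \<union> {\<tau><..<t}) ?f"
    by (intro L2_on_Un 1 2 3 fmeasurable.Un lmeasurable_interval(2) neg[THEN negligible_imp_measurable])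
  ultimately show ?thesis by (simp add: M2_def)
qed

end

section \<open>Dynamic programming\<close>

text \<open>Turns uniqueness in L2 into pointwise equality of continuous controls, endpoints
  included.\<close>

lemma continuous_L2_zero:
  fixes f :: "real \<Rightarrow> real^'n"
  assumes "a < b" "continuous_on {a..b} f" "(LINT x:{a..b}|lebesgue. (norm (f x))\<^sup>2) \<le> 0" "x \<in> {a..b}"
  shows "f x = 0"
proof -
  have c: "continuous_on {a..b} (\<lambda>x. (norm (f x))\<^sup>2)" by (intro continuous_intros assms)
  have "0 \<le> (LINT x:{a..b}|lebesgue. (norm (f x))\<^sup>2)"
    unfolding set_lebesgue_integral_def by (rule integral_nonneg_AE) auto
  then have "((\<lambda>x. (norm (f x))\<^sup>2) has_integral 0) (cbox a b)"
    using has_integral_set_lebesgue[OF absolutely_integrable_continuous_real[OF c]] assms(3) by simp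
  then have "(norm (f x))\<^sup>2 = 0"
    using c assms(1,4) by (intro has_integral_0_cbox_imp_0[of a b "\<lambda>x. (norm (f x))\<^sup>2"]) auto
  then show ?thesis by simp
qed

context lq_problem
begin

abbreviation "cost \<equiv> running_cost C y"
abbreviation "Jf \<equiv> J A B C N y T"
abbreviation "Wf \<equiv> W A B C N y T"

lemma N_integrable:
  assumes "f absolutely_integrable_on S" "S \<in> sets lebesgue" "\<And>s. s \<in> S \<Longrightarrow> r - s \<in> {0..T}"
  shows "(\<lambda>s. N (r - s) *v f s) absolutely_integrable_on S"
proof -
  have "(\<lambda>s. N (r - s) *v f s) absolutely_integrable_on S
      \<longleftrightarrow> (\<lambda>s. N' (r - s) *v f s) absolutely_integrable_on S"
    using assms(3) by (intro set_integrable_cong) (auto simp: N'_eq)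
  then show ?thesis using kernel_mult_integrable[OF kernel_N' assms(1,2)] by blast
qed

text \<open>Both sides integrate over the same past of the trajectory up to \<open>r\<close>; only
  the cut between history and current solution moves from \<open>\<tau>\<close> to
  \<open>t\<close>.\<close>

lemma memory_shift:
  assumes "0 \<le> \<tau>" "\<tau> \<le> t" "t \<le> r" "r \<le> T" "\<Xi> \<in> M2 \<tau>" "continuous_on {\<tau>..r} w"
  shows "(LINT s:{\<tau>..r}|lebesgue. N (r - s) *v w s) + (LINT s:{0<..<\<tau>}|lebesgue. N (r - s) *v snd \<Xi> s)
    = (LINT s:{t..r}|lebesgue. N (r - s) *v w s)
      + (LINT s:{0<..<t}|lebesgue. N (r - s) *v snd (state_of \<tau> \<Xi> w t) s)"
proof -
  define f where "f s = N (r - s) *v (if s < \<tau> then snd \<Xi> s else w s)" for s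
  have w: "(\<lambda>s. N (r - s) *v w s) absolutely_integrable_on {\<tau>..r}"
    by (rule N_integrable) (use assms in \<open>auto intro!: absolutely_integrable_continuous_real\<close>)
  have xi: "(\<lambda>s. N (r - s) *v snd \<Xi> s) absolutely_integrable_on {0<..<\<tau>}"
    by (rule N_integrable) (use assms in \<open>auto intro!: M2_integrable\<close>)
  have "f absolutely_integrable_on {0<..<\<tau>} \<longleftrightarrow> (\<lambda>s. N (r - s) *v snd \<Xi> s) absolutely_integrable_on {0<..<\<tau>}"
    by (rule set_integrable_cong) (auto simp: f_def)
  then have f1: "f absolutely_integrable_on {0<..<\<tau>}" using xi by blast
  have "f absolutely_integrable_on {\<tau>..t} \<longleftrightarrow> (\<lambda>s. N (r - s) *v w s) absolutely_integrable_on {\<tau>..t}"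
    by (rule set_integrable_cong) (auto simp: f_def)
  moreover have "(\<lambda>s. N (r - s) *v w s) absolutely_integrable_on {\<tau>..t}"
    by (rule set_integrable_subset[OF w]) (use assms in auto)
  ultimately have f2: "f absolutely_integrable_on {\<tau>..t}" by blast
  have "(LINT s:{0<..<t}|lebesgue. N (r - s) *v snd (state_of \<tau> \<Xi> w t) s) = (LINT s:{0<..<t}|lebesgue. f s)"
    by (rule set_lebesgue_integral_cong) (auto simp: f_def state_of_def)
  also have "\<dots> = (LINT s:{0<..<\<tau>} \<union> {\<tau>..t}|lebesgue. f s)"
    \<comment> \<open>The two sets differ in \<open>t\<close> and, if \<open>\<tau> = 0\<close>,
      possibly in \<open>0\<close>.\<close>
    by (rule set_integral_discrete_difference[where X = "{0, t}"]) (use assms in auto)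
  also have "\<dots> = (LINT s:{0<..<\<tau>}|lebesgue. f s) + (LINT s:{\<tau>..t}|lebesgue. f s)"
    by (rule set_integral_Un) (use f1 f2 in auto)
  also have "(LINT s:{0<..<\<tau>}|lebesgue. f s) = (LINT s:{0<..<\<tau>}|lebesgue. N (r - s) *v snd \<Xi> s)"
    by (rule set_lebesgue_integral_cong) (auto simp: f_def)
  also have "(LINT s:{\<tau>..t}|lebesgue. f s) = (LINT s:{\<tau>..t}|lebesgue. N (r - s) *v w s)"
    by (rule set_lebesgue_integral_cong) (auto simp: f_def)
  finally show ?thesis using LINT_split[OF w, of t] assms(2,3) by simp
qed

text \<open>The flow property: \<open>w\<close> and \<open>w'\<close> are kept, and
  \<open>memory_shift\<close> shows that the right-hand side is the same when the piece over
  \<open>[\<tau>, t]\<close> counts as history.\<close>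

lemma is_sol_shift:
  assumes "0 \<le> \<tau>" "\<tau> \<le> t" "t \<le> e" "e \<le> T" "\<Xi> \<in> M2 \<tau>"
    and w: "is_sol e \<tau> \<Xi> u w" and wc: "continuous_on {\<tau>..e} w"
  shows "is_sol e t (state_of \<tau> \<Xi> w t) u w"
proof -
  obtain w' where w': "has_ae_derivative_on w w' \<tau> e"
    "AE r in lebesgue. r \<in> {\<tau>..e} \<longrightarrow>
       w' r = A *v w r + (LINT s:{\<tau>..r}|lebesgue. N (r - s) *v w s) + B *v u r
              + (LINT s:{0<..<\<tau>}|lebesgue. N (r - s) *v snd \<Xi> s)"
    using w unfolding is_solution_def by (elim conjE exE)
  have ai: "w' absolutely_integrable_on {\<tau>..e}"
    and wr: "\<And>r. r \<in> {\<tau>..e} \<Longrightarrow> w r = w \<tau> + (LINT q:{\<tau>..r}|lebesgue. w' q)"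
    using w'(1) unfolding has_ae_derivative_on_def by (rule conjunct1, elim conjE bspec)
  have "has_ae_derivative_on w w' t e"
    unfolding has_ae_derivative_on_def
  proof (intro conjI ballI)
    show "w' absolutely_integrable_on {t..e}"
      by (rule set_integrable_subset[OF ai]) (use assms(2) in auto)
    fix r assume r: "r \<in> {t..e}"
    have "w' absolutely_integrable_on {\<tau>..r}"
      by (rule set_integrable_subset[OF ai]) (use assms(2) r in auto)
    from LINT_split[OF this, of t]
    have "(LINT q:{\<tau>..r}|lebesgue. w' q) = (LINT q:{\<tau>..t}|lebesgue. w' q) + (LINT q:{t..r}|lebesgue. w' q)"
      using r assms(2) by simp
    moreover have "w r = w \<tau> + (LINT q:{\<tau>..r}|lebesgue. w' q)" by (rule wr) (use r assms(2) in auto)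
    moreover have "w t = w \<tau> + (LINT q:{\<tau>..t}|lebesgue. w' q)" by (rule wr) (use assms(2,3) in auto)
    ultimately show "w r = w t + (LINT q:{t..r}|lebesgue. w' q)" by (simp only: add.assoc)
  qed
  moreover have "AE r in lebesgue. r \<in> {t..e} \<longrightarrow>
       w' r = A *v w r + (LINT s:{t..r}|lebesgue. N (r - s) *v w s) + B *v u r
              + (LINT s:{0<..<t}|lebesgue. N (r - s) *v snd (state_of \<tau> \<Xi> w t) s)"
    using w'(2)
  proof eventually_elim
    case (elim r)
    show ?case
    proof
      assume r: "r \<in> {t..e}"
      have "continuous_on {\<tau>..r} w" by (rule continuous_on_subset[OF wc]) (use r in auto)
      from memory_shift[OF assms(1,2) _ _ assms(5) this]
      have "(LINT s:{\<tau>..r}|lebesgue. N (r - s) *v w s) + (LINT s:{0<..<\<tau>}|lebesgue. N (r - s) *v snd \<Xi> s)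
        = (LINT s:{t..r}|lebesgue. N (r - s) *v w s)
          + (LINT s:{0<..<t}|lebesgue. N (r - s) *v snd (state_of \<tau> \<Xi> w t) s)"
        using r assms(4) by simp
      moreover have "w' r = A *v w r + (LINT s:{\<tau>..r}|lebesgue. N (r - s) *v w s) + B *v u r
              + (LINT s:{0<..<\<tau>}|lebesgue. N (r - s) *v snd \<Xi> s)"
        by (rule elim[THEN mp]) (use r assms(2) in auto)
      ultimately show "w' r = A *v w r + (LINT s:{t..r}|lebesgue. N (r - s) *v w s) + B *v u r
              + (LINT s:{0<..<t}|lebesgue. N (r - s) *v snd (state_of \<tau> \<Xi> w t) s)"
        by (simp only: add_ac)
    qed
  qed
  ultimately show ?thesis
    unfolding is_solution_def by (intro conjI exI[of _ w']) (simp add: state_of_def)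
qed

lemma cost_integrable:
  assumes "0 \<le> a" "b \<le> T" "continuous_on {a..b} w" "L2_on {a<..<b} u"
  shows "(\<lambda>r. cost r (w r) (u r)) absolutely_integrable_on {a..b}"
  unfolding running_cost_def
proof (rule set_integral_add(1)[OF _ L2_on_Ioo(2)[OF assms(4)]],
    intro absolutely_integrable_continuous_real continuous_intros)
  show "continuous_on {a..b} (\<lambda>x. C *v w x)"
    by (rule bounded_linear.continuous_on[OF matrix_vector_mul_bounded_linear assms(3)])
  show "continuous_on {a..b} y" by (rule continuous_on_subset[OF y_continuous]) (use assms in auto)
qed

lemma J_eq:
  assumes "0 \<le> \<tau>" "\<tau> \<le> T" "\<Xi> \<in> M2 \<tau>" "L2_on {\<tau><..<T} u" "is_sol T \<tau> \<Xi> u w"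
  shows "Jf \<tau> \<Xi> u = (LINT r:{\<tau>..T}|lebesgue. cost r (w r) (u r))"
  unfolding J_def
  by (rule set_lebesgue_integral_cong)
    (use traj_eq[OF assms(1,2) order_refl assms(3) L2_on_Ioo(1)[OF assms(4)] assms(5)] in auto)

lemma J_nonneg: "0 \<le> Jf \<tau> \<Xi> u"
  unfolding J_def set_lebesgue_integral_def by (rule integral_nonneg_AE) (auto simp: running_cost_def)

lemma J_cong:
  assumes "0 \<le> \<tau>" "\<tau> \<le> T" "\<Xi> \<in> M2 \<tau>" "L2_on {\<tau><..<T} u" "\<And>r. r \<in> {\<tau>..T} \<Longrightarrow> u r = v r"
  shows "Jf \<tau> \<Xi> u = Jf \<tau> \<Xi> v"
proof -
  have v: "L2_on {\<tau><..<T} v" using assms(4,5) by (subst L2_on_cong[of _ _ u]) auto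
  obtain w where w: "is_sol T \<tau> \<Xi> u w"
    using is_sol_exists[OF assms(1,2) order_refl assms(3) L2_on_Ioo(1)[OF assms(4)]] by blast
  have w2: "is_sol T \<tau> \<Xi> v w" by (rule is_sol_restrict[OF w]) (use assms(5) in auto)
  show ?thesis
    unfolding J_eq[OF assms(1-4) w] J_eq[OF assms(1-3) v w2]
    by (rule set_lebesgue_integral_cong) (use assms(5) in auto)
qed

text \<open>By \<open>is_sol_shift\<close> the tail of \<open>w\<close> is the trajectory started
  from the state at \<open>t\<close>, so the cost splits as the integral does.\<close>

lemma J_split:
  assumes "0 \<le> \<tau>" "\<tau> \<le> t" "t \<le> T" "\<Xi> \<in> M2 \<tau>" "L2_on {\<tau><..<T} u" and w: "is_sol T \<tau> \<Xi> u w"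
  shows "state_of \<tau> \<Xi> w t \<in> M2 t"
    "Jf \<tau> \<Xi> u = (LINT r:{\<tau>..t}|lebesgue. cost r (w r) (u r)) + Jf t (state_of \<tau> \<Xi> w t) u"
proof -
  have \<tau>T: "\<tau> \<le> T" using assms by simp
  have wc: "continuous_on {\<tau>..T} w"
    by (rule is_sol_continuous[OF assms(1) \<tau>T order_refl assms(4) L2_on_Ioo(1)[OF assms(5)] w])
  show M: "state_of \<tau> \<Xi> w t \<in> M2 t"
    by (rule state_of_in_M2[OF assms(1,4) _ assms(2)], rule continuous_on_subset[OF wc]) (use assms(3) in auto)
  have "L2_on {t<..<T} u" by (rule L2_on_subset[OF assms(5)]) (use assms(2) in auto)
  from J_eq[OF _ assms(3) M this is_sol_shift[OF assms(1-3) order_refl assms(4) w wc]]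
  have "Jf t (state_of \<tau> \<Xi> w t) u = (LINT r:{t..T}|lebesgue. cost r (w r) (u r))"
    using assms(1,2) by simp
  then show "Jf \<tau> \<Xi> u = (LINT r:{\<tau>..t}|lebesgue. cost r (w r) (u r)) + Jf t (state_of \<tau> \<Xi> w t) u"
    using J_eq[OF assms(1) \<tau>T assms(4,5) w] assms(2,3)
      LINT_split[OF cost_integrable[OF assms(1) order_refl wc assms(5)], of t] by simp
qed

text \<open>The difference \<open>z\<close> of two trajectories is the response from rest to
  \<open>h = v - u\<close>. In the expansion of the cost the linear part vanishes by
  \<open>orth\<close>, and the square of \<open>C *v z\<close> is discarded.\<close>

lemma strict_minimizer_exists:
  assumes \<tau>: "0 \<le> \<tau>" "\<tau> < T" and \<Xi>: "\<Xi> \<in> M2 \<tau>"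
  obtains u where "continuous_on {\<tau>..T} u"
    "\<And>v. L2_on {\<tau><..<T} v \<Longrightarrow> Jf \<tau> \<Xi> u + (LINT r:{\<tau>..T}|lebesgue. (norm (v r - u r))\<^sup>2) \<le> Jf \<tau> \<Xi> v"
proof -
  have \<tau>T: "\<tau> \<le> T" using \<tau> by simp
  let ?I = "\<lambda>f. LINT s:{\<tau>..T}|lebesgue. f s"
  interpret S: memory_system A N' \<tau> T by (rule memory_system) fact
  have "continuous_on (cbox \<tau> T) y"
    by (rule continuous_on_subset[OF y_continuous]) (use \<tau> in auto)
  then have "\<exists>Y :: real \<Rightarrow>\<^sub>C (real^'p). \<forall>r\<in>cbox \<tau> T. Y r = y r"
    by (rule continuous_on_cbox_bcontfunE) (intro exI ballI)
  then obtain Y :: "real \<Rightarrow>\<^sub>C (real^'p)" where "\<forall>r\<in>cbox \<tau> T. Y r = y r" ..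
  then have Y: "Y r = y r" if "r \<in> {\<tau>..T}" for r using that by simp
  have mem: "memory \<tau> \<Xi> absolutely_integrable_on {\<tau>..T}"
    by (intro absolutely_integrable_continuous_real memory_continuous \<Xi>)
  obtain u :: "real \<Rightarrow>\<^sub>C (real^'m)" and w :: "real \<Rightarrow>\<^sub>C (real^'d)"
    where w: "S.sol (fst \<Xi>) (force \<tau> \<Xi> u) w"
      and orth: "\<And>h z. h absolutely_integrable_on {\<tau>..T} \<Longrightarrow> S.sol 0 (\<lambda>s. B *v h s) z \<Longrightarrow>
        ?I (\<lambda>s. (C *v w s - Y s) \<bullet> (C *v z s)) + ?I (\<lambda>s. u s \<bullet> h s) = 0"
    using S.optimal_control_exists[OF \<tau>(2) mem, of "fst \<Xi>" B C Y] by blast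
  have uL: "L2_on {\<tau><..<T} u" by (rule L2_on_continuous) simp
  note ui = L2_on_Ioo(1)[OF uL]
  have w_sol: "is_sol T \<tau> \<Xi> u w" unfolding is_solution_iff[OF \<tau>(1) \<tau>T order_refl \<Xi> ui] by (rule w)
  show thesis
  proof (rule that[of u])
    fix v :: "real \<Rightarrow> real^'m" assume vL: "L2_on {\<tau><..<T} v"
    note vi = L2_on_Ioo(1)[OF vL]
    obtain wv where wv: "is_sol T \<tau> \<Xi> v wv" using is_sol_exists[OF \<tau>(1) \<tau>T order_refl \<Xi> vi] by blast
    have wvc: "continuous_on {\<tau>..T} wv" by (rule is_sol_continuous[OF \<tau>(1) \<tau>T order_refl \<Xi> vi wv])
    define z where "z r = wv r - w r" for r
    define h where "h r = v r - u r" for r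
    have zc: "continuous_on {\<tau>..T} z" unfolding z_def by (intro continuous_intros wvc) simp
    have hi: "h absolutely_integrable_on {\<tau>..T}" unfolding h_def[abs_def] by (rule set_integral_diff(1)[OF vi ui])
    have "S.sol (fst \<Xi> - fst \<Xi>) (\<lambda>s. force \<tau> \<Xi> v s - force \<tau> \<Xi> u s) z"
      unfolding z_def
      by (rule S.sol_diff[OF force_integrable[OF \<Xi> vi] force_integrable[OF \<Xi> ui] _ w])
        (use wv in \<open>simp only: is_solution_iff[OF \<tau>(1) \<tau>T order_refl \<Xi> vi]\<close>)
    then have "S.sol 0 (\<lambda>s. B *v h s) z" by (simp add: h_def matrix_vector_mult_diff_distrib)
    from orth[OF hi this] have orth': "?I (\<lambda>s. (C *v w s - Y s) \<bullet> (C *v z s)) + ?I (\<lambda>s. u s \<bullet> h s) = 0" .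
    have Mc: "continuous_on {\<tau>..T} (\<lambda>s. C *v z s)" "continuous_on {\<tau>..T} (\<lambda>s. C *v w s)"
      by (rule bounded_linear.continuous_on[OF matrix_vector_mul_bounded_linear], simp_all add: zc)+
    have i1: "(\<lambda>s. cost s (w s) (u s)) absolutely_integrable_on {\<tau>..T}"
      by (rule cost_integrable[OF \<tau>(1) order_refl _ uL]) simp
    have i2: "(\<lambda>s. (C *v w s - Y s) \<bullet> (C *v z s)) absolutely_integrable_on {\<tau>..T}"
      "(\<lambda>s. (norm (C *v z s))\<^sup>2) absolutely_integrable_on {\<tau>..T}"
      by (intro absolutely_integrable_continuous_real continuous_intros Mc; simp)+
    have i3: "(\<lambda>s. u s \<bullet> h s) absolutely_integrable_on {\<tau>..T}"
      by (rule inner_absolutely_integrable[OF _ hi]) simp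
    \<comment> \<open>The square of \<open>h\<close> is expressed by the squares of \<open>v\<close>
      and \<open>u\<close> and the product of \<open>h\<close> with the continuous \<open>u\<close>,
      all known to be integrable.\<close>
    have i4: "(\<lambda>s. (norm (h s))\<^sup>2) absolutely_integrable_on {\<tau>..T}"
    proof -
      have "(\<lambda>s. (norm (v s))\<^sup>2 - (norm (u s))\<^sup>2 - 2 * (u s \<bullet> h s)) absolutely_integrable_on {\<tau>..T}"
        by (intro set_integral_diff(1) L2_on_Ioo(2) uL vL set_integrable_mult_right i3)
      then show ?thesis
        by (simp add: h_def power2_norm_eq_inner inner_diff_left inner_diff_right inner_commute algebra_simps)
    qed
    have "Jf \<tau> \<Xi> v = ?I (\<lambda>s. cost s (wv s) (v s))" by (rule J_eq[OF \<tau>(1) \<tau>T \<Xi> vL wv])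
    also have "\<dots> = ?I (\<lambda>s. cost s (w s) (u s) + 2 * ((C *v w s - Y s) \<bullet> (C *v z s) + u s \<bullet> h s)
        + ((norm (C *v z s))\<^sup>2 + (norm (h s))\<^sup>2))"
    proof (rule set_lebesgue_integral_cong, simp, intro allI impI)
      fix s assume s: "s \<in> {\<tau>..T}"
      have "(norm (C *v wv s - y s))\<^sup>2 = (norm ((C *v w s - Y s) + C *v z s))\<^sup>2"
        by (simp add: Y[OF s] z_def matrix_vector_mult_diff_distrib)
      moreover have "(norm (v s))\<^sup>2 = (norm (u s + h s))\<^sup>2" by (simp add: h_def)
      ultimately show "cost s (wv s) (v s) = cost s (w s) (u s)
          + 2 * ((C *v w s - Y s) \<bullet> (C *v z s) + u s \<bullet> h s) + ((norm (C *v z s))\<^sup>2 + (norm (h s))\<^sup>2)"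
        by (simp add: running_cost_def Y[OF s, symmetric] power2_norm_eq_inner inner_add_left inner_add_right
            inner_commute)
    qed
    also have "\<dots> = ?I (\<lambda>s. cost s (w s) (u s))
        + 2 * (?I (\<lambda>s. (C *v w s - Y s) \<bullet> (C *v z s)) + ?I (\<lambda>s. u s \<bullet> h s))
        + (?I (\<lambda>s. (norm (C *v z s))\<^sup>2) + ?I (\<lambda>s. (norm (h s))\<^sup>2))"
      by (simp only: set_integral_add set_integral_mult_right set_integrable_mult_right i1 i2 i3 i4)
    also have "\<dots> = Jf \<tau> \<Xi> u + (?I (\<lambda>s. (norm (C *v z s))\<^sup>2) + ?I (\<lambda>s. (norm (h s))\<^sup>2))"
      unfolding orth' J_eq[OF \<tau>(1) \<tau>T \<Xi> uL w_sol] by simp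
    moreover have "0 \<le> ?I (\<lambda>s. (norm (C *v z s))\<^sup>2)"
      unfolding set_lebesgue_integral_def by (rule integral_nonneg_AE) auto
    ultimately show "Jf \<tau> \<Xi> u + ?I (\<lambda>r. (norm (v r - u r))\<^sup>2) \<le> Jf \<tau> \<Xi> v"
      by (simp add: h_def)
  qed simp
qed

section \<open>The optimal control and the value function\<close>

abbreviation "up \<equiv> uplus A B C N y T"

text \<open>\<open>uplus\<close> is chosen merely as a continuous minimizer. It is identified with
  the minimizer constructed before, from which it inherits the quadratic lower bound.\<close>

lemma uplus_minimizer:
  assumes \<tau>: "0 \<le> \<tau>" "\<tau> < T" and \<Xi>: "\<Xi> \<in> M2 \<tau>"
  shows uplus_continuous: "continuous_on {\<tau>..T} (up \<tau> \<Xi>)"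
    and uplus_strict: "L2_on {\<tau><..<T} v \<Longrightarrow>
      Jf \<tau> \<Xi> (up \<tau> \<Xi>) + (LINT r:{\<tau>..T}|lebesgue. (norm (v r - up \<tau> \<Xi> r))\<^sup>2) \<le> Jf \<tau> \<Xi> v"
proof -
  obtain u where u: "continuous_on {\<tau>..T} u"
    and min: "\<And>v. L2_on {\<tau><..<T} v \<Longrightarrow>
      Jf \<tau> \<Xi> u + (LINT r:{\<tau>..T}|lebesgue. (norm (v r - u r))\<^sup>2) \<le> Jf \<tau> \<Xi> v"
    by (fact strict_minimizer_exists[OF \<tau> \<Xi>])
  have nonneg: "0 \<le> (LINT r:{\<tau>..T}|lebesgue. (norm (v r - u r))\<^sup>2)" for v :: "real \<Rightarrow> real^'m"
    unfolding set_lebesgue_integral_def by (rule integral_nonneg_AE) auto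
  have uL: "L2_on {\<tau><..<T} u" by (rule L2_on_continuous[OF u])
  let ?P = "\<lambda>u. continuous_on {\<tau>..T} u \<and> L2_on {\<tau><..<T} u \<and>
    (\<forall>v. L2_on {\<tau><..<T} v \<longrightarrow> Jf \<tau> \<Xi> u \<le> Jf \<tau> \<Xi> v)"
  have "Jf \<tau> \<Xi> u \<le> Jf \<tau> \<Xi> v" if "L2_on {\<tau><..<T} v" for v
    using min[OF that] nonneg[of v] by linarith
  with u uL have "?P u" by blast
  then have up: "?P (up \<tau> \<Xi>)" unfolding uplus_def by (rule someI[of ?P])
  then show c: "continuous_on {\<tau>..T} (up \<tau> \<Xi>)" by blast
  \<comment> \<open>Strictness at \<open>v = up \<tau> \<Xi>\<close> bounds this integral by the
    difference of two costs, which is at most 0 because \<open>up \<tau> \<Xi>\<close> is a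
    minimizer too.\<close>
  have "(LINT r:{\<tau>..T}|lebesgue. (norm (up \<tau> \<Xi> r - u r))\<^sup>2) \<le> 0"
    using min[of "up \<tau> \<Xi>"] up uL by fastforce
  then have eq: "up \<tau> \<Xi> r = u r" if "r \<in> {\<tau>..T}" for r
    using continuous_L2_zero[OF \<tau>(2) continuous_on_diff[OF c u] _ that] by simp
  have "Jf \<tau> \<Xi> (up \<tau> \<Xi>) = Jf \<tau> \<Xi> u"
    by (rule J_cong[OF \<tau>(1) _ \<Xi>]) (use up \<tau>(2) eq in auto)
  moreover have "(LINT r:{\<tau>..T}|lebesgue. (norm (v r - up \<tau> \<Xi> r))\<^sup>2)
      = (LINT r:{\<tau>..T}|lebesgue. (norm (v r - u r))\<^sup>2)"
    by (rule set_lebesgue_integral_cong) (simp_all add: eq)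
  moreover assume "L2_on {\<tau><..<T} v"
  ultimately show "Jf \<tau> \<Xi> (up \<tau> \<Xi>) + (LINT r:{\<tau>..T}|lebesgue. (norm (v r - up \<tau> \<Xi> r))\<^sup>2) \<le> Jf \<tau> \<Xi> v"
    using min[of v] by simp
qed

lemma uplus_L2: "0 \<le> \<tau> \<Longrightarrow> \<tau> < T \<Longrightarrow> \<Xi> \<in> M2 \<tau> \<Longrightarrow> L2_on {\<tau><..<T} (up \<tau> \<Xi>)"
  by (rule L2_on_continuous[OF uplus_continuous])

lemma uplus_le:
  assumes "0 \<le> \<tau>" "\<tau> < T" "\<Xi> \<in> M2 \<tau>" "L2_on {\<tau><..<T} v"
  shows "Jf \<tau> \<Xi> (up \<tau> \<Xi>) \<le> Jf \<tau> \<Xi> v"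
proof -
  have "0 \<le> (LINT r:{\<tau>..T}|lebesgue. (norm (v r - up \<tau> \<Xi> r))\<^sup>2)"
    unfolding set_lebesgue_integral_def by (rule integral_nonneg_AE) auto
  with uplus_strict[OF assms] show ?thesis by linarith
qed

lemma W_eq:
  assumes "0 \<le> \<tau>" "\<tau> < T" "\<Xi> \<in> M2 \<tau>"
  shows "Wf \<tau> \<Xi> = Jf \<tau> \<Xi> (up \<tau> \<Xi>)"
  unfolding W_def using assms(2)
  by (simp, intro Least_equality) (use uplus_le[OF assms] uplus_L2[OF assms] in blast)+

text \<open>Reconciles the value \<open>0\<close> of \<open>W\<close> at \<open>T\<close> with the
  cost, so that \<open>W_attained\<close> includes \<open>t = T\<close>.\<close>

lemma J_final: "Jf T \<Xi> u = 0"
  unfolding J_def set_lebesgue_integral_def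
  by (rule integral_eq_zero_AE, rule AE_mp[OF AE_not_endpoint[of T]]) (auto intro!: AE_I2)

lemma W_le:
  assumes "0 \<le> t" "t \<le> T" "\<Xi> \<in> M2 t" "L2_on {t<..<T} v"
  shows "Wf t \<Xi> \<le> Jf t \<Xi> v"
proof (cases "t < T")
  case True
  then show ?thesis using W_eq[of t \<Xi>] uplus_le[OF assms(1) True assms(3,4)] assms by simp
qed (use J_nonneg in \<open>simp add: W_def\<close>)

lemma W_attained:
  assumes "0 \<le> t" "t \<le> T" "\<Xi> \<in> M2 t"
  obtains v where "L2_on {t<..<T} v" "Wf t \<Xi> = Jf t \<Xi> v"
proof (cases "t < T")
  case True
  show thesis
    by (rule that[OF uplus_L2[OF assms(1) True assms(3)] W_eq[OF assms(1) True assms(3)]])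
next
  case False
  then have "t = T" using assms(2) by simp
  moreover have "L2_on {t<..<T} (\<lambda>_. 0 :: real^'m)" by (rule L2_on_continuous) simp
  ultimately show thesis using that[of "\<lambda>_. 0"] by (simp add: J_final W_def)
qed

text \<open>The trajectory ends at \<open>t\<close>, because the control is given only on
  \<open>[\<tau>, t]\<close>.\<close>

abbreviation "incurred \<tau> \<Xi> u t \<equiv> (LINT r:{\<tau>..t}|lebesgue. cost r (traj A B N t \<tau> \<Xi> u r) (u r))"

text \<open>A solution for \<open>v\<close> on \<open>[\<tau>, T]\<close> restricts to one for
  \<open>u\<close> on \<open>[\<tau>, t]\<close>, so \<open>J_split\<close> can be read with the
  state and the cost belonging to \<open>u\<close>.\<close>

lemma dynamic_programming:
  assumes "0 \<le> \<tau>" "\<tau> \<le> t" "t \<le> T" and \<Xi>: "\<Xi> \<in> M2 \<tau>" and v: "L2_on {\<tau><..<T} v"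
    and u: "L2_on {\<tau><..<t} u" "\<And>r. r \<in> {\<tau>..<t} \<Longrightarrow> u r = v r"
  shows "state A B N t \<tau> \<Xi> u t \<in> M2 t"
    and "Jf \<tau> \<Xi> v = incurred \<tau> \<Xi> u t + Jf t (state A B N t \<tau> \<Xi> u t) v"
proof -
  have \<tau>T: "\<tau> \<le> T" using assms by simp
  obtain w where w: "is_sol T \<tau> \<Xi> v w"
    using is_sol_exists[OF assms(1) \<tau>T order_refl \<Xi> L2_on_Ioo(1)[OF v]] by blast
  have wc: "continuous_on {\<tau>..t} w"
    by (rule continuous_on_subset[OF is_sol_continuous[OF assms(1) \<tau>T order_refl \<Xi> L2_on_Ioo(1)[OF v] w]])
      (use assms(3) in auto)
  have wu: "is_sol t \<tau> \<Xi> u w" by (rule is_sol_restrict[OF w assms(3) u(2)])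
  note ui = L2_on_Ioo(1)[OF u(1)]
  have st: "state A B N t \<tau> \<Xi> u t = state_of \<tau> \<Xi> w t"
    by (rule state_eq[OF assms(1-3) \<Xi> ui wu]) (use assms(2) in auto)
  show "state A B N t \<tau> \<Xi> u t \<in> M2 t" unfolding st by (rule J_split(1)[OF assms(1-3) \<Xi> v w])
  have "incurred \<tau> \<Xi> u t = (LINT r:{\<tau>..t}|lebesgue. cost r (w r) (u r))"
    by (rule set_lebesgue_integral_cong) (use traj_eq[OF assms(1-3) \<Xi> ui wu] in auto)
  also have "\<dots> = (LINT r:{\<tau>..t}|lebesgue. cost r (w r) (v r))"
  proof (rule LINT_cong_AE)
    show "AE r in lebesgue. r \<in> {\<tau>..t} \<longrightarrow> cost r (w r) (u r) = cost r (w r) (v r)"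
      by (rule AE_mp[OF AE_not_endpoint[of t]]) (auto intro!: AE_I2 simp: u(2))
    have "L2_on {\<tau><..<t} v" by (rule L2_on_subset[OF v]) (use assms(3) in auto)
    then show "(\<lambda>r. cost r (w r) (v r)) absolutely_integrable_on {\<tau>..t}"
      by (rule cost_integrable[OF assms(1,3) wc])
  qed (rule cost_integrable[OF assms(1,3) wc u(1)])
  finally show "Jf \<tau> \<Xi> v = incurred \<tau> \<Xi> u t + Jf t (state A B N t \<tau> \<Xi> u t) v"
    using J_split(2)[OF assms(1-3) \<Xi> v w] st by simp
qed

text \<open>Follow \<open>u\<close> up to \<open>t\<close>, then a control that is optimal for the
  state reached; the cost is the right-hand side of the integral inequality.\<close>

lemma glue_controls:
  assumes "0 \<le> \<tau>" "\<tau> < t" "t \<le> T" and \<Xi>: "\<Xi> \<in> M2 \<tau>" and u: "L2_on {\<tau><..<t} u"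
  obtains v where "L2_on {\<tau><..<T} v" "\<And>r. r \<in> {\<tau>..<t} \<Longrightarrow> u r = v r"
    "Jf \<tau> \<Xi> v = incurred \<tau> \<Xi> u t + Wf t (state A B N t \<tau> \<Xi> u t)"
proof -
  let ?S = "state A B N t \<tau> \<Xi> u t"
  have L2: "L2_on {\<tau><..<T} (\<lambda>r. if r < t then u r else v r)" if "L2_on {t<..<T} v" for v
  proof -
    let ?v = "\<lambda>r. if r < t then u r else v r"
    have "L2_on {\<tau><..<t} ?v" using u by (subst L2_on_cong[of _ _ u]) auto
    moreover have "L2_on {t<..<T} ?v" using that by (subst L2_on_cong[of _ _ v]) auto
    moreover have neg: "negligible ({t} \<inter> {\<tau><..<T})" by (rule negligible_subset[of "{t}"]) auto
    moreover have "L2_on ({t} \<inter> {\<tau><..<T}) ?v"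
      unfolding L2_on_iff[OF neg[THEN negligible_imp_measurable]]
      by (intro conjI absolutely_integrable_negligible neg)
    ultimately have "L2_on ({\<tau><..<t} \<union> ({t} \<inter> {\<tau><..<T}) \<union> {t<..<T}) ?v"
      by (intro L2_on_Un fmeasurable.Un lmeasurable_interval(2) neg[THEN negligible_imp_measurable])
    moreover have "{\<tau><..<T} = {\<tau><..<t} \<union> ({t} \<inter> {\<tau><..<T}) \<union> {t<..<T}" using assms(2,3) by auto
    ultimately show ?thesis by simp
  qed
  have \<tau>t: "\<tau> \<le> t" using assms(2) by simp
  \<comment> \<open>The zero control serves as a continuation of \<open>u\<close> to
    \<open>[\<tau>, T]\<close>, just to place the state in \<open>M2 t\<close>.\<close>
  have "L2_on {t<..<T} (\<lambda>_. 0 :: real^'m)" by (rule L2_on_continuous) simp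
  then have S: "?S \<in> M2 t"
    by (rule dynamic_programming(1)[OF assms(1) \<tau>t assms(3) \<Xi> L2 u]) simp
  have t0: "0 \<le> t" using assms by simp
  obtain v where v: "L2_on {t<..<T} v" "Wf t ?S = Jf t ?S v"
    by (rule W_attained[OF t0 assms(3) S])
  let ?v = "\<lambda>r. if r < t then u r else v r"
  have "Jf t ?S v = Jf t ?S ?v"
    by (rule J_cong[OF t0 assms(3) S v(1)]) auto
  then show thesis
    using v(2) dynamic_programming(2)[OF assms(1) \<tau>t assms(3) \<Xi> L2[OF v(1)] u]
    by (intro that[of ?v] L2[OF v(1)]) auto
qed

text \<open>The glued control competes in the minimum defining \<open>W\<close> at
  \<open>\<tau>\<close>, which gives the inequality. Equality makes it a minimizer, hence equal to
  \<open>u\<^sup>+\<close> by strictness.\<close>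

lemma dissipation_integral:
  assumes \<tau>: "0 \<le> \<tau>" "\<tau> < t" "t \<le> T" and \<Xi>: "\<Xi> \<in> M2 \<tau>" and u: "continuous_on {\<tau>..t} u"
  shows "Wf \<tau> \<Xi> \<le> incurred \<tau> \<Xi> u t + Wf t (state A B N t \<tau> \<Xi> u t)" (is "_ \<le> ?rhs")
    and "Wf \<tau> \<Xi> = incurred \<tau> \<Xi> u t + Wf t (state A B N t \<tau> \<Xi> u t)
      \<longleftrightarrow> (\<forall>r\<in>{\<tau>..<t}. u r = up \<tau> \<Xi> r)"
proof -
  have \<tau>T: "\<tau> < T" "\<tau> \<le> t" using \<tau> by simp_all
  have uL: "L2_on {\<tau><..<t} u" by (rule L2_on_continuous[OF u])
  note Weq = W_eq[OF \<tau>(1) \<tau>T(1) \<Xi>]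
  note upL = uplus_L2[OF \<tau>(1) \<tau>T(1) \<Xi>]
  obtain v where v: "L2_on {\<tau><..<T} v" "\<And>r. r \<in> {\<tau>..<t} \<Longrightarrow> u r = v r" "Jf \<tau> \<Xi> v = ?rhs"
    using glue_controls[OF \<tau> \<Xi> uL] by blast
  show le: "Wf \<tau> \<Xi> \<le> ?rhs" using uplus_le[OF \<tau>(1) \<tau>T(1) \<Xi> v(1)] v(3) Weq by simp
  show "Wf \<tau> \<Xi> = ?rhs \<longleftrightarrow> (\<forall>r\<in>{\<tau>..<t}. u r = up \<tau> \<Xi> r)"
  proof
    assume "Wf \<tau> \<Xi> = ?rhs"
    then have 0: "(LINT r:{\<tau>..T}|lebesgue. (norm (v r - up \<tau> \<Xi> r))\<^sup>2) \<le> 0"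
      using uplus_strict[OF \<tau>(1) \<tau>T(1) \<Xi> v(1)] v(3) Weq by simp
    have upc: "continuous_on {\<tau>..t} (up \<tau> \<Xi>)"
      by (rule continuous_on_subset[OF uplus_continuous[OF \<tau>(1) \<tau>T(1) \<Xi>]]) (use \<tau>(3) in auto)
    \<comment> \<open>Integrability of the squared difference permits cutting its integral at
      \<open>t\<close> and keeping the part over \<open>[\<tau>, t]\<close>, where both functions
      compared are continuous once \<open>v\<close> is replaced by \<open>u\<close>.\<close>
    have D: "L2_on {\<tau><..<T} (\<lambda>r. v r - up \<tau> \<Xi> r)"
    proof -
      have "(\<lambda>r. (norm (v r))\<^sup>2 - 2 * (up \<tau> \<Xi> r \<bullet> v r) + (norm (up \<tau> \<Xi> r))\<^sup>2) absolutely_integrable_on {\<tau>..T}"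
        by (intro set_integral_add(1) set_integral_diff(1) set_integrable_mult_right L2_on_Ioo(2) v(1) upL
            inner_absolutely_integrable uplus_continuous[OF \<tau>(1) \<tau>T(1) \<Xi>] L2_on_Ioo(1))
      then have "(\<lambda>r. (norm (v r - up \<tau> \<Xi> r))\<^sup>2) absolutely_integrable_on {\<tau>..T}"
        by (simp add: power2_norm_eq_inner inner_diff_left inner_diff_right inner_commute algebra_simps)
      then show ?thesis
        unfolding L2_on_iff[OF lmeasurable_interval(2)] absolutely_integrable_on_Icc_iff_Ioo[symmetric]
        by (intro conjI set_integral_diff(1) L2_on_Ioo(1) v(1) upL)
    qed
    have "(LINT r:{\<tau>..t}|lebesgue. (norm (u r - up \<tau> \<Xi> r))\<^sup>2)
        = (LINT r:{\<tau>..t}|lebesgue. (norm (v r - up \<tau> \<Xi> r))\<^sup>2)"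
    proof (rule LINT_cong_AE)
      show "(\<lambda>r. (norm (u r - up \<tau> \<Xi> r))\<^sup>2) absolutely_integrable_on {\<tau>..t}"
        by (intro absolutely_integrable_continuous_real continuous_intros u upc)
      show "(\<lambda>r. (norm (v r - up \<tau> \<Xi> r))\<^sup>2) absolutely_integrable_on {\<tau>..t}"
        by (rule set_integrable_subset[OF L2_on_Ioo(2)[OF D]]) (use \<tau>(3) in auto)
      show "AE r in lebesgue. r \<in> {\<tau>..t} \<longrightarrow> (norm (u r - up \<tau> \<Xi> r))\<^sup>2 = (norm (v r - up \<tau> \<Xi> r))\<^sup>2"
        by (rule AE_mp[OF AE_not_endpoint[of t]]) (auto intro!: AE_I2 simp: v(2))
    qed
    also have "\<dots> \<le> (LINT r:{\<tau>..T}|lebesgue. (norm (v r - up \<tau> \<Xi> r))\<^sup>2)"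
    proof -
      have "0 \<le> (LINT r:{t..T}|lebesgue. (norm (v r - up \<tau> \<Xi> r))\<^sup>2)"
        unfolding set_lebesgue_integral_def by (rule integral_nonneg_AE) auto
      then show ?thesis using LINT_split[OF L2_on_Ioo(2)[OF D], of t] \<tau>(2,3) by simp
    qed
    finally have "(LINT r:{\<tau>..t}|lebesgue. (norm (u r - up \<tau> \<Xi> r))\<^sup>2) \<le> 0" using 0 by simp
    from continuous_L2_zero[OF \<tau>(2) continuous_on_diff[OF u upc] this]
    show "\<forall>r\<in>{\<tau>..<t}. u r = up \<tau> \<Xi> r" by simp
  next
    assume eq: "\<forall>r\<in>{\<tau>..<t}. u r = up \<tau> \<Xi> r"
    let ?S = "state A B N t \<tau> \<Xi> u t"
    note dp = dynamic_programming[OF \<tau>(1) \<tau>T(2) \<tau>(3) \<Xi> upL uL eq[rule_format]]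
    \<comment> \<open>Conversely, the tail of the optimal control competes in the minimum at
      \<open>t\<close>, so \<open>W\<close> at the state reached cannot exceed the cost of that
      tail.\<close>
    have "L2_on {t<..<T} (up \<tau> \<Xi>)" by (rule L2_on_subset[OF upL]) (use \<tau>(2) in auto)
    then have "Wf t ?S \<le> Jf t ?S (up \<tau> \<Xi>)" using dp(1) \<tau> by (intro W_le) auto
    then have "?rhs \<le> Wf \<tau> \<Xi>" using dp(2) Weq by simp
    with le show "Wf \<tau> \<Xi> = ?rhs" by simp
  qed
qed

text \<open>The integral form on \<open>[\<tau>, \<tau> + h]\<close>, divided by \<open>h\<close>,
  bounds the difference quotient below by minus an average of the running cost, which converges as
  that cost is continuous along the trajectory. For the optimal control the two coincide.\<close>

lemma dissipation_differential:
  assumes \<tau>: "0 \<le> \<tau>" "\<tau> < T" and \<Xi>: "\<Xi> \<in> M2 \<tau>" and u: "continuous_on {\<tau>..T} u"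
  defines "L \<equiv> Liminf (at_right 0) (\<lambda>h. ereal ((Wf (\<tau> + h) (state A B N T \<tau> \<Xi> u (\<tau> + h)) - Wf \<tau> \<Xi>) / h))"
  shows "ereal (- cost \<tau> (fst \<Xi>) (u \<tau>)) \<le> L"
    and "\<forall>r\<in>{\<tau>..T}. u r = up \<tau> \<Xi> r \<Longrightarrow> ereal (- cost \<tau> (fst \<Xi>) (u \<tau>)) = L"
proof -
  have \<tau>T: "\<tau> \<le> T" using \<tau> by simp
  have uL: "L2_on {\<tau><..<T} u" by (rule L2_on_continuous[OF u])
  note ui = L2_on_Ioo(1)[OF uL]
  obtain w where w: "is_sol T \<tau> \<Xi> u w" using is_sol_exists[OF \<tau>(1) \<tau>T order_refl \<Xi> ui] by blast
  have wc: "continuous_on {\<tau>..T} w" by (rule is_sol_continuous[OF \<tau>(1) \<tau>T order_refl \<Xi> ui w])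
  define f where "f r = cost r (w r) (u r)" for r
  define q where "q h = (Wf (\<tau> + h) (state A B N T \<tau> \<Xi> u (\<tau> + h)) - Wf \<tau> \<Xi>) / h" for h
  define a where "a h = - (integral {\<tau>..\<tau> + h} f / h)" for h
  have fc: "continuous_on {\<tau>..T} f"
    unfolding f_def running_cost_def
  proof (intro continuous_intros u)
    show "continuous_on {\<tau>..T} (\<lambda>r. C *v w r)"
      by (rule bounded_linear.continuous_on[OF matrix_vector_mul_bounded_linear wc])
    show "continuous_on {\<tau>..T} y" by (rule continuous_on_subset[OF y_continuous]) (use \<tau> in auto)
  qed
  have f\<tau>: "f \<tau> = cost \<tau> (fst \<Xi>) (u \<tau>)" using w by (simp add: f_def is_solution_def)
  have "((\<lambda>r. integral {\<tau>..r} f) has_vector_derivative f \<tau>) (at \<tau> within {\<tau>..T})"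
    using \<tau>T by (intro integral_has_vector_derivative[OF fc]) simp
  then have "((\<lambda>r. integral {\<tau>..r} f) has_real_derivative f \<tau>) (at \<tau> within {\<tau>..T})"
    by (simp add: has_real_derivative_iff_has_vector_derivative)
  then have "((\<lambda>r. (integral {\<tau>..r} f - integral {\<tau>..\<tau>} f) / (r - \<tau>)) \<longlongrightarrow> f \<tau>) (at_right \<tau>)"
    unfolding has_field_derivative_iff using \<tau>(2) by (simp add: at_within_Icc_at_right)
  then have "((\<lambda>h. integral {\<tau>..\<tau> + h} f / h) \<longlongrightarrow> f \<tau>) (at_right 0)"
    by (simp add: filterlim_at_right_to_0[of _ _ \<tau>] add.commute)
  then have a_lim: "((\<lambda>h. ereal (a h)) \<longlongrightarrow> ereal (- f \<tau>)) (at_right 0)"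
    unfolding a_def by (intro tendsto_intros)
  have ev: "eventually (\<lambda>h. 0 < h \<and> h < T - \<tau>) (at_right 0)"
    using eventually_at_right_real[of 0 "T - \<tau>"] \<tau>(2) by (auto elim: eventually_mono)
  have ineq: "a h \<le> q h" "\<forall>r\<in>{\<tau>..T}. u r = up \<tau> \<Xi> r \<Longrightarrow> a h = q h" if h: "0 < h \<and> h < T - \<tau>" for h
  proof -
    let ?t = "\<tau> + h"
    have t: "\<tau> < ?t" "\<tau> \<le> ?t" "?t \<le> T" using h by auto
    have ut: "continuous_on {\<tau>..?t} u" by (rule continuous_on_subset[OF u]) (use t in auto)
    note uti = L2_on_Ioo(1)[OF L2_on_continuous[OF ut]]
    have wt: "is_sol ?t \<tau> \<Xi> u w" by (rule is_sol_restrict[OF w t(3)]) simp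
    \<comment> \<open>The integral form uses the trajectory of the control on
      \<open>[\<tau>, ?t]\<close>, the difference quotient that of the control on
      \<open>[\<tau>, T]\<close>; both give the same state at \<open>?t\<close>.\<close>
    have st: "state A B N ?t \<tau> \<Xi> u ?t = state A B N T \<tau> \<Xi> u ?t"
      using state_eq[OF \<tau>(1) t(2,3) \<Xi> uti wt, of ?t] state_eq[OF \<tau>(1) \<tau>T order_refl \<Xi> ui w, of ?t] t by simp
    have "incurred \<tau> \<Xi> u ?t = (LINT r:{\<tau>..?t}|lebesgue. f r)"
      unfolding f_def
      by (rule set_lebesgue_integral_cong) (use traj_eq[OF \<tau>(1) t(2,3) \<Xi> uti wt] in auto)
    also have "\<dots> = integral {\<tau>..?t} f"
      by (intro set_lebesgue_integral_eq_integral(2) absolutely_integrable_continuous_real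
          continuous_on_subset[OF fc]) (use t in auto)
    finally have inc: "incurred \<tau> \<Xi> u ?t = integral {\<tau>..?t} f" .
    note di = dissipation_integral[OF \<tau>(1) t(1,3) \<Xi> ut, unfolded inc st]
    have "- integral {\<tau>..?t} f \<le> Wf ?t (state A B N T \<tau> \<Xi> u ?t) - Wf \<tau> \<Xi>"
      using di(1) by linarith
    from divide_right_mono[OF this, of h] h show "a h \<le> q h" by (simp add: a_def q_def)
    assume "\<forall>r\<in>{\<tau>..T}. u r = up \<tau> \<Xi> r"
    then have "\<forall>r\<in>{\<tau>..<?t}. u r = up \<tau> \<Xi> r" using t by auto
    then have "Wf ?t (state A B N T \<tau> \<Xi> u ?t) - Wf \<tau> \<Xi> = - integral {\<tau>..?t} f" using di(2) by simp
    then show "a h = q h" by (simp add: a_def q_def)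
  qed
  have La: "Liminf (at_right 0) (\<lambda>h. ereal (a h)) = ereal (- f \<tau>)"
    by (rule lim_imp_Liminf[OF _ a_lim]) simp
  have Lq: "L = Liminf (at_right 0) (\<lambda>h. ereal (q h))" by (simp add: L_def q_def)
  have "Liminf (at_right 0) (\<lambda>h. ereal (a h)) \<le> Liminf (at_right 0) (\<lambda>h. ereal (q h))"
    by (rule Liminf_mono) (use ev in \<open>eventually_elim, simp add: ineq(1)\<close>)
  then show "ereal (- cost \<tau> (fst \<Xi>) (u \<tau>)) \<le> L" by (simp only: La Lq f\<tau>)
  assume "\<forall>r\<in>{\<tau>..T}. u r = up \<tau> \<Xi> r"
  then have "Liminf (at_right 0) (\<lambda>h. ereal (a h)) = Liminf (at_right 0) (\<lambda>h. ereal (q h))"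
    by (intro Liminf_eq) (use ev in \<open>eventually_elim, simp add: ineq(2)\<close>)
  then show "ereal (- cost \<tau> (fst \<Xi>) (u \<tau>)) = L" by (simp only: La Lq f\<tau>)
qed

end

theorem mainTheorem4:
  fixes T \<tau> :: real
    and A :: "real ^ 'd ^ 'd" and B :: "real ^ 'm ^ 'd" and C :: "real ^ 'd ^ 'p"
    and N :: "real \<Rightarrow> real ^ 'd ^ 'd" and y :: "real \<Rightarrow> real ^ 'p"
    and \<Xi> :: "(real ^ 'd) \<times> (real \<Rightarrow> real ^ 'd)"
  assumes "T > 0"
    and "continuous_on {0..T} N"
    and "continuous_on {0..T} y"
    and "\<tau> \<in> {0..<T}"
    and "\<Xi> \<in> M2 \<tau>"
  shows
    "(\<forall>t\<in>{\<tau><..T}. \<forall>u :: real \<Rightarrow> real ^ 'm. continuous_on {\<tau>..t} u \<longrightarrow>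
        W A B C N y T \<tau> \<Xi>
          \<le> (LINT r:{\<tau>..t}|lebesgue. running_cost C y r (traj A B N t \<tau> \<Xi> u r) (u r))
             + W A B C N y T t (state A B N t \<tau> \<Xi> u t)
        \<and> (W A B C N y T \<tau> \<Xi>
             = (LINT r:{\<tau>..t}|lebesgue. running_cost C y r (traj A B N t \<tau> \<Xi> u r) (u r))
                + W A B C N y T t (state A B N t \<tau> \<Xi> u t)
           \<longleftrightarrow> (\<forall>r\<in>{\<tau>..<t}. u r = uplus A B C N y T \<tau> \<Xi> r)))
   \<and> (\<forall>u :: real \<Rightarrow> real ^ 'm. continuous_on {\<tau>..T} u \<longrightarrow>
        ereal (- running_cost C y \<tau> (fst \<Xi>) (u \<tau>))
          \<le> Liminf (at_right 0) (\<lambda>h. ereal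
               ((W A B C N y T (\<tau> + h) (state A B N T \<tau> \<Xi> u (\<tau> + h)) - W A B C N y T \<tau> \<Xi>) / h))
        \<and> ((\<forall>r\<in>{\<tau>..T}. u r = uplus A B C N y T \<tau> \<Xi> r) \<longrightarrow>
             ereal (- running_cost C y \<tau> (fst \<Xi>) (u \<tau>))
               = Liminf (at_right 0) (\<lambda>h. ereal
                   ((W A B C N y T (\<tau> + h) (state A B N T \<tau> \<Xi> u (\<tau> + h)) - W A B C N y T \<tau> \<Xi>) / h))))"
proof -
  \<comment> \<open>Extends \<open>N\<close> to a bounded continuous function on the line, as
    \<open>lq_problem\<close> requires.\<close>
  have "continuous_on (cbox 0 T) N" using assms(2) by simp
  then have "\<exists>N' :: real \<Rightarrow>\<^sub>C (real^'d^'d). \<forall>t\<in>cbox 0 T. N' t = N t"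
    by (rule continuous_on_cbox_bcontfunE) (intro exI ballI)
  then obtain N' :: "real \<Rightarrow>\<^sub>C (real^'d^'d)" where N': "\<forall>t\<in>cbox 0 T. N' t = N t" ..
  interpret lq_problem A B C N "apply_bcontfun N'" y T
    by unfold_locales (use assms(1,3) N' in auto)
  have \<tau>: "0 \<le> \<tau>" "\<tau> < T" using assms(4) by auto
  show ?thesis
  proof (intro conjI ballI allI impI)
    fix t u assume "t \<in> {\<tau><..T}" and u: "continuous_on {\<tau>..t} (u :: real \<Rightarrow> real^'m)"
    then have t: "\<tau> < t" "t \<le> T" by auto
    show "Wf \<tau> \<Xi> \<le> incurred \<tau> \<Xi> u t + Wf t (state A B N t \<tau> \<Xi> u t)"
      by (rule dissipation_integral(1)[OF \<tau>(1) t assms(5) u])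
    show "Wf \<tau> \<Xi> = incurred \<tau> \<Xi> u t + Wf t (state A B N t \<tau> \<Xi> u t)
        \<longleftrightarrow> (\<forall>r\<in>{\<tau>..<t}. u r = up \<tau> \<Xi> r)"
      by (rule dissipation_integral(2)[OF \<tau>(1) t assms(5) u])
  next
    fix u assume u: "continuous_on {\<tau>..T} (u :: real \<Rightarrow> real^'m)"
    show "ereal (- cost \<tau> (fst \<Xi>) (u \<tau>)) \<le> Liminf (at_right 0)
        (\<lambda>h. ereal ((Wf (\<tau> + h) (state A B N T \<tau> \<Xi> u (\<tau> + h)) - Wf \<tau> \<Xi>) / h))"
      by (rule dissipation_differential(1)[OF \<tau> assms(5) u])
    assume "\<forall>r\<in>{\<tau>..T}. u r = up \<tau> \<Xi> r"
    then show "ereal (- cost \<tau> (fst \<Xi>) (u \<tau>)) = Liminf (at_right 0)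
        (\<lambda>h. ereal ((Wf (\<tau> + h) (state A B N T \<tau> \<Xi> u (\<tau> + h)) - Wf \<tau> \<Xi>) / h))"
      by (rule dissipation_differential(2)[OF \<tau> assms(5) u])
  qed
qed

end
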